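(* Let $n\ge 2$, $0\le m\le n$, and let $W=(w_{jk})$ be a constant zero-one $n\times n$-matrix. For functions $q_{jk}\in C^1(\mathbb{R}_+)$, $j,k\le n$, consider the problem $$\partial_t u_j + a_j(x,t)\partial_x u_j + b_j(x,t)u_j = 0,\quad 0<x<1,\ t>0,\ j\le n,$$ $$u_j(0,t) = \sum_{k=1}^m p_{jk}(t)u_k(1,t)+\sum_{k=m+1}^n p_{jk}(t)u_k(0,t),\quad t\ge 0,\ 1\le j\le m,$$ $$u_j(1,t) = \sum_{k=1}^m p_{jk}(t)u_k(1,t)+\sum_{k=m+1}^n p_{jk}(t)u_k(0,t),\quad t\ge 0,\ m<j\le n,$$ $$u_j(x,0)=\varphi_j(x),\quad 0\le x\le 1,\ j\le n,$$ with $p_{jk}(t)=q_{jk}(t)w_{jk}$. Then this problem is robust finite time stabilizable for every choice of $q_{jk}\in C^1(\mathbb{R}_+)$, $j,k\le n$, if and only if the matrix $W$ fulfills one of the following conditions: (ii) the products $w_{i_1i_2}w_{i_2i_3}\cdots w_{i_ni_{n+1}}$ equal zero for all tuples $(i_1,\dots,i_{n+1})\in\{1,\dots,n\}^{n+1}$; (iii) all principal minors of the matrix $W$ equal zero; (iv) the matrix $W$ is nilpotent, with $W^n=0$.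
   Context: Let $\Pi=\{(x,t): 0\le x\le 1,\ 0\le t<\infty\}$ and $\mathbb{R}_+=[0,\infty)$. All functions are real-valued; $L^2(0,1)^n$ is normed by $\|u\|=\max_{j\le n}\|u_j\|_{L^2(0,1)}$. Admissible coefficients: (a) there is $a>0$ with $a_j\ge a$ on $\Pi$ for $1\le j\le m$ and $a_j\le -a$ on $\Pi$ for $m+1\le j\le n$; (b) $a_j,b_j\in C^1(\Pi)$ are bounded in $\Pi$ together with their first order derivatives. $C_0^\infty([0,1])$ is the space of functions in $C^\infty([0,1])$ with support within $(0,1)$. For $\varphi\in L^2(0,1)^n$, a function $u\in C([0,\infty),L^2(0,1))^n$ is an $L^2$-generalized solution if for any sequence $\varphi^l\in C_0^\infty([0,1])^n$ with $\varphi^l\to\varphi$ in $L^2(0,1)^n$, the (unique) classical $C^1$-solutions $u^l$ in $\Pi$ with initial data $\varphi^l$ satisfy $\|u(\cdot,t)-u^l(\cdot,t)\|_{L^2(0,1)^n}\to 0$ as $l\to\infty$, uniformly in $t\in[0,T]$ for each $T>0$. The problem is finite time stabilizable (FTS) if there exists $T_e>0$ such that for every $\varphi\in L^2(0,1)^n$ the $L^2$-generalized solution is zero for all $t>T_e$. It is robust FTS if it is FTS for any admissible coefficients $a_j,b_j$ (with $m$ and the boundary coefficients $p_{jk}(\cdot)$ fixed). A principal minor of an $n\times n$ matrix is the determinant of its restriction to the rows and columns with the same set of indices $j_1<\dots<j_l$, $1\le l\le n$. *)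

theory Defs
  imports
    "HOL-Analysis.Analysis"
    "Jordan_Normal_Form.Determinant"
    "Jordan_Normal_Form.DL_Submatrix"
begin

(* Indices run over 0, ..., n - 1 instead of 1, ..., n; the first m components are those with
   index j < m.  A vector function of (x, t) is u :: nat => real => real => real, applied as
   u j x t, and only its values for j < n and (x, t) in the strip matter. *)

definition strip :: "(real \<times> real) set" where
  "strip = {0..1} \<times> {0..}"

(* f is C^1 on the closed strip, with first order derivatives fx and ft;
   on the boundary the derivatives are one-sided. *)
definition C1_strip ::
  "(real \<Rightarrow> real \<Rightarrow> real) \<Rightarrow> (real \<Rightarrow> real \<Rightarrow> real) \<Rightarrow> (real \<Rightarrow> real \<Rightarrow> real) \<Rightarrow> bool" where
  "C1_strip f fx ft \<longleftrightarrow>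
     continuous_on strip (\<lambda>(x, t). f x t) \<and>
     continuous_on strip (\<lambda>(x, t). fx x t) \<and>
     continuous_on strip (\<lambda>(x, t). ft x t) \<and>
     (\<forall>x\<in>{0..1}. \<forall>t\<in>{0..}.
        ((\<lambda>y. f y t) has_real_derivative fx x t) (at x within {0..1}) \<and>
        ((\<lambda>s. f x s) has_real_derivative ft x t) (at t within {0..}))"

definition C1_halfline :: "(real \<Rightarrow> real) \<Rightarrow> bool" where
  "C1_halfline q \<longleftrightarrow>
     (\<exists>q'. continuous_on {0..} q' \<and>
        (\<forall>t\<ge>0. (q has_real_derivative q' t) (at t within {0..})))"

definition C1_bounded_strip :: "(real \<Rightarrow> real \<Rightarrow> real) \<Rightarrow> bool" where
  "C1_bounded_strip f \<longleftrightarrow>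
     (\<exists>fx ft C. C1_strip f fx ft \<and>
        (\<forall>x\<in>{0..1}. \<forall>t\<in>{0..}. \<bar>f x t\<bar> \<le> C \<and> \<bar>fx x t\<bar> \<le> C \<and> \<bar>ft x t\<bar> \<le> C))"

definition admissible ::
  "nat \<Rightarrow> nat \<Rightarrow> (nat \<Rightarrow> real \<Rightarrow> real \<Rightarrow> real) \<Rightarrow> (nat \<Rightarrow> real \<Rightarrow> real \<Rightarrow> real) \<Rightarrow> bool" where
  "admissible n m a b \<longleftrightarrow>
     (\<exists>a0>0. \<forall>x\<in>{0..1}. \<forall>t\<in>{0..}.
        (\<forall>j<m. a j x t \<ge> a0) \<and> (\<forall>j\<in>{m..<n}. a j x t \<le> - a0)) \<and>
     (\<forall>j<n. C1_bounded_strip (a j) \<and> C1_bounded_strip (b j))"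

(* C^infinity on [0,1] (the k-th derivative is D k, one-sided at the endpoints),
   with support contained in the open interval. *)
definition test_function :: "(real \<Rightarrow> real) \<Rightarrow> bool" where
  "test_function f \<longleftrightarrow>
     (\<exists>D :: nat \<Rightarrow> real \<Rightarrow> real. D 0 = f \<and>
        (\<forall>k. \<forall>x\<in>{0..1}. (D k has_real_derivative D (Suc k) x) (at x within {0..1}))) \<and>
     closure {x\<in>{0..1}. f x \<noteq> 0} \<subseteq> {0<..<1}"

definition L2 :: "(real \<Rightarrow> real) set" where
  "L2 = {f. f \<in> borel_measurable (lebesgue_on {0<..<1}) \<and>
            integrable (lebesgue_on {0<..<1}) (\<lambda>x. (f x)\<^sup>2)}"

(* Meaningful for f in L2 only: the Bochner integral of a non-integrable function is 0. *)
definition L2_norm :: "(real \<Rightarrow> real) \<Rightarrow> real" where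
  "L2_norm f = sqrt (\<integral>x. (f x)\<^sup>2 \<partial>lebesgue_on {0<..<1})"

definition L2_norm_vec :: "nat \<Rightarrow> (nat \<Rightarrow> real \<Rightarrow> real) \<Rightarrow> real" where
  "L2_norm_vec n f = Max ((\<lambda>j. L2_norm (f j)) ` {..<n})"

definition C_L2 :: "(real \<Rightarrow> real \<Rightarrow> real) \<Rightarrow> bool" where
  "C_L2 v \<longleftrightarrow>
     (\<forall>t\<ge>0. (\<lambda>x. v x t) \<in> L2) \<and>
     (\<forall>t\<ge>0. ((\<lambda>s. L2_norm (\<lambda>x. v x s - v x t)) \<longlongrightarrow> 0) (at t within {0..}))"

(* The common right-hand side of both boundary conditions. *)
definition boundary_rhs ::
  "nat \<Rightarrow> nat \<Rightarrow> (nat \<Rightarrow> nat \<Rightarrow> real \<Rightarrow> real) \<Rightarrow> (nat \<Rightarrow> real \<Rightarrow> real \<Rightarrow> real) \<Rightarrow> nat \<Rightarrow> real \<Rightarrow> real" where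
  "boundary_rhs n m p u j t =
     (\<Sum>k<m. p j k t * u k 1 t) + (\<Sum>k=m..<n. p j k t * u k 0 t)"

definition classical_solution ::
  "nat \<Rightarrow> nat \<Rightarrow> (nat \<Rightarrow> real \<Rightarrow> real \<Rightarrow> real) \<Rightarrow> (nat \<Rightarrow> real \<Rightarrow> real \<Rightarrow> real) \<Rightarrow>
   (nat \<Rightarrow> nat \<Rightarrow> real \<Rightarrow> real) \<Rightarrow> (nat \<Rightarrow> real \<Rightarrow> real) \<Rightarrow> (nat \<Rightarrow> real \<Rightarrow> real \<Rightarrow> real) \<Rightarrow> bool" where
  "classical_solution n m a b p \<phi> u \<longleftrightarrow>
     (\<forall>j<n. \<exists>ux ut. C1_strip (u j) ux ut \<and>
        (\<forall>x t. 0 < x \<and> x < 1 \<and> 0 < t \<longrightarrow> ut x t + a j x t * ux x t + b j x t * u j x t = 0)) \<and>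
     (\<forall>j<m. \<forall>t\<ge>0. u j 0 t = boundary_rhs n m p u j t) \<and>
     (\<forall>j\<in>{m..<n}. \<forall>t\<ge>0. u j 1 t = boundary_rhs n m p u j t) \<and>
     (\<forall>j<n. \<forall>x\<in>{0..1}. u j x 0 = \<phi> j x)"

(* For data phi l vanishing near the endpoints, the classical solution ul l exists and its values
   on the strip are unique, so the existential quantifier over ul refers to the classical solutions. *)
definition L2_generalized_solution ::
  "nat \<Rightarrow> nat \<Rightarrow> (nat \<Rightarrow> real \<Rightarrow> real \<Rightarrow> real) \<Rightarrow> (nat \<Rightarrow> real \<Rightarrow> real \<Rightarrow> real) \<Rightarrow>
   (nat \<Rightarrow> nat \<Rightarrow> real \<Rightarrow> real) \<Rightarrow> (nat \<Rightarrow> real \<Rightarrow> real) \<Rightarrow> (nat \<Rightarrow> real \<Rightarrow> real \<Rightarrow> real) \<Rightarrow> bool" where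
  "L2_generalized_solution n m a b p \<phi> u \<longleftrightarrow>
     (\<forall>j<n. C_L2 (u j)) \<and>
     (\<forall>\<phi>l :: nat \<Rightarrow> nat \<Rightarrow> real \<Rightarrow> real.
        (\<forall>l. \<forall>j<n. test_function (\<phi>l l j)) \<longrightarrow>
        (\<lambda>l. L2_norm_vec n (\<lambda>j x. \<phi>l l j x - \<phi> j x)) \<longlonglongrightarrow> 0 \<longrightarrow>
        (\<exists>ul. (\<forall>l. classical_solution n m a b p (\<phi>l l) (ul l)) \<and>
           (\<forall>T>0. uniform_limit {0..T}
              (\<lambda>l t. L2_norm_vec n (\<lambda>j x. u j x t - ul l j x t)) (\<lambda>t. 0) sequentially)))"

(* The problem is well posed: for phi in L2 and p of class C^1 the L2-generalized solution exists and
   is unique (up to null sets), so u ranges over the versions of "the" generalized solution. *)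
definition FTS ::
  "nat \<Rightarrow> nat \<Rightarrow> (nat \<Rightarrow> real \<Rightarrow> real \<Rightarrow> real) \<Rightarrow> (nat \<Rightarrow> real \<Rightarrow> real \<Rightarrow> real) \<Rightarrow>
   (nat \<Rightarrow> nat \<Rightarrow> real \<Rightarrow> real) \<Rightarrow> bool" where
  "FTS n m a b p \<longleftrightarrow>
     (\<exists>Te>0. \<forall>\<phi>. (\<forall>j<n. \<phi> j \<in> L2) \<longrightarrow>
        (\<forall>u. L2_generalized_solution n m a b p \<phi> u \<longrightarrow>
           (\<forall>t>Te. \<forall>j<n. AE x in lebesgue_on {0<..<1}. u j x t = 0)))"

definition robust_FTS :: "nat \<Rightarrow> nat \<Rightarrow> (nat \<Rightarrow> nat \<Rightarrow> real \<Rightarrow> real) \<Rightarrow> bool" where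
  "robust_FTS n m p \<longleftrightarrow> (\<forall>a b. admissible n m a b \<longrightarrow> FTS n m a b p)"

definition walk_products_vanish :: "nat \<Rightarrow> real mat \<Rightarrow> bool" where
  "walk_products_vanish n W \<longleftrightarrow>
     (\<forall>i :: nat \<Rightarrow> nat. (\<forall>s\<in>{1..n + 1}. i s < n) \<longrightarrow> (\<Prod>s=1..n. W $$ (i s, i (s + 1))) = 0)"

definition principal_minors_vanish :: "nat \<Rightarrow> real mat \<Rightarrow> bool" where
  "principal_minors_vanish n W \<longleftrightarrow>
     (\<forall>I. I \<noteq> {} \<and> I \<subseteq> {..<n} \<longrightarrow> Determinant.det (submatrix W I I) = 0)"

end

theory Submission
  imports Defs
begin

text \<open>Regard \<open>W\<close> as a directed graph with an edge from \<open>j\<close> to \<open>k\<close> when \<open>W $$ (j, k) \<noteq> 0\<close>: the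
value of \<open>u j\<close> at its inflow end is fed by the outflow values of the successors \<open>u k\<close>.  All the
conditions say that this graph has no cycle.  Instead of cycles the proof uses the notion of a
\<^emph>\<open>sinkless\<close> set of vertices, a nonempty set in which each vertex has a successor; such a set exists
exactly when there is a cycle, and it is easier to handle than a cyclic sequence.

The algebraic equivalences.  A sinkless set carries walks of every length, and a walk of length \<open>n\<close>
must visit some vertex twice, so that the vertices between the two visits form a sinkless set.  As the
entries of \<open>W\<close> are nonnegative, the entries of \<open>W ^\<^sub>m s\<close> detect walks without cancellation.  If there
is no sinkless set, each principal submatrix has a zero row.  Conversely, in a \<^emph>\<open>minimal\<close> sinkless set
each vertex has exactly one successor, and passing to the successor permutes the set: otherwise a smaller
sinkless set could be extracted.  The corresponding principal submatrix is therefore a permutation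
matrix and its determinant is nonzero (\<open>minimal_sinkless_det\<close>).

Nilpotent matrices give finite time stability for all admissible coefficients.  If \<open>|a j| \<ge> a0\<close>, a component
whose inflow vanishes from time \<open>T\<close> on is zero from time \<open>T + 1 / a0\<close> on (\<open>zero_after_crossing_time\<close>).
By induction on \<open>s\<close>, \<open>u j\<close> is zero after time \<open>s / a0\<close> as soon as no walk of length \<open>s\<close> starts at \<open>j\<close>, that
is, as soon as row \<open>j\<close> of \<open>W ^\<^sub>m s\<close> is zero; with \<open>s = n\<close> this covers all components.  The characteristics
are not constructed: a maximum principle along the backward characteristic direction replaces them.
Passing from classical to generalized solutions requires an approximation of \<open>L\<^sup>2\<close> data by test functions
(\<open>test_functions_dense_L2\<close>).

A sinkless set destroys finite time stability for one choice of the data.  Take \<open>q = 1\<close>, \<open>a = \<plusminus>1\<close> and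
\<open>b = 0\<close>, and measure the position \<open>y\<close> of a component from its inflow end.  Then all components are
travelling waves \<open>w j (y - t)\<close> and the boundary conditions read \<open>w (- t) = W w (1 - t)\<close>, whence
\<open>w (y - N) = W\<^sup>N w y\<close> for \<open>0 < y < 1\<close>.  This formula gives the solution for every initial function
that vanishes near the ends, and the change of variables in the \<open>L\<^sup>2\<close> norm shows that it is also the
generalized solution (\<open>wave_solution_generalized\<close>).  Starting from the same positive bump in every
component, at each time \<open>N\<close> some component is a bump times a row sum of \<open>W\<^sup>N\<close>, which is positive for
some row because walks of length \<open>N\<close> exist.\<close>

section \<open>Cycles of a nonnegative matrix\<close>

text \<open>Existence of such a set means that the graph of \<open>W\<close> has a cycle.  Sets are preferable to cyclic
sequences because minimal ones exist and can be analysed by replacing successor functions.\<close>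
definition sinkless :: "nat \<Rightarrow> real mat \<Rightarrow> nat set \<Rightarrow> bool" where
  "sinkless n W I \<longleftrightarrow> I \<noteq> {} \<and> I \<subseteq> {..<n} \<and> (\<forall>i\<in>I. \<exists>k\<in>I. W $$ (i, k) \<noteq> 0)"

text \<open>The rows of \<open>submatrix W I I\<close> are numbered by \<open>pick I\<close>, so this bijection translates between
vertices in \<open>I\<close> and indices of the submatrix.\<close>
lemma bij_betw_pick:
  assumes "finite I"
  shows "bij_betw (pick I) {..<card I} I"
proof -
  have sub: "I \<subseteq> pick I ` {..<card I}"
  proof
    fix i assume i: "i \<in> I"
    have "card {a\<in>I. a < i} < card I"
      using i assms by (intro psubset_card_mono) auto
    then show "i \<in> pick I ` {..<card I}"
      using image_eqI[of i "pick I" "card {a\<in>I. a < i}" "{..<card I}"] pick_card_in_set[OF i] by simp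
  qed
  have "card (pick I ` {..<card I}) \<le> card I"
    by (metis card_image_le card_lessThan finite_lessThan)
  then have eq: "pick I ` {..<card I} = I"
    using sub assms by (metis card_seteq finite_imageI finite_lessThan)
  then have "inj_on (pick I) {..<card I}"
    by (intro eq_card_imp_inj_on) auto
  with eq show ?thesis by (simp add: bij_betw_def)
qed

lemma det_zero_row:
  fixes A :: "'a :: comm_ring_1 mat"
  assumes A: "A \<in> carrier_mat l l" and r: "r < l" and z: "\<And>c. c < l \<Longrightarrow> A $$ (r, c) = 0"
  shows "Determinant.det A = 0"
  unfolding det_def'[OF A]
proof (intro sum.neutral ballI)
  fix p assume "p \<in> {p. p permutes {0..<l}}"
  then have "p r < l" using r by (auto dest: permutes_in_image[of _ _ r])
  then have "(\<Prod>i = 0..<l. A $$ (i, p i)) = 0"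
    using r z by (intro prod_zero) (auto intro!: bexI[of _ r])
  then show "signof p * (\<Prod>i = 0..<l. A $$ (i, p i)) = 0" by simp
qed

text \<open>In the Leibniz formula, every permutation other than \<open>p0\<close> meets a zero entry in a row where it
differs from \<open>p0\<close>, so one nonzero product is left.\<close>
lemma det_permutation_pattern:
  fixes A :: "'a :: idom mat"
  assumes A: "A \<in> carrier_mat l l" and p0: "p0 permutes {0..<l}"
    and pat: "\<And>r c. r < l \<Longrightarrow> c < l \<Longrightarrow> A $$ (r, c) \<noteq> 0 \<longleftrightarrow> c = p0 r"
  shows "Determinant.det A \<noteq> 0"
proof -
  have im: "p r < l" if "p permutes {0..<l}" "r < l" for p r
    using that by (auto dest: permutes_in_image[of _ _ r])
  have "Determinant.det A = (\<Sum>p\<in>{p. p permutes {0..<l}}. signof p * (\<Prod>i = 0..<l. A $$ (i, p i)))"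
    by (rule det_def'[OF A])
  also have "\<dots> = (\<Sum>p\<in>{p0}. signof p * (\<Prod>i = 0..<l. A $$ (i, p i)))"
  proof (rule sum.mono_neutral_right)
    show "finite {p. p permutes {0..<l}}" by (simp add: finite_permutations)
    show "{p0} \<subseteq> {p. p permutes {0..<l}}" using p0 by simp
    show "\<forall>p\<in>{p. p permutes {0..<l}} - {p0}. signof p * (\<Prod>i = 0..<l. A $$ (i, p i)) = 0"
    proof
      fix p assume p: "p \<in> {p. p permutes {0..<l}} - {p0}"
      then obtain r where r: "p r \<noteq> p0 r" by blast
      have "r < l" using r p p0 by (metis DiffD1 atLeastLessThan_iff mem_Collect_eq permutes_not_in zero_le)
      moreover have "A $$ (r, p r) = 0" using pat[of r "p r"] im[of p r] p r \<open>r < l\<close> by auto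
      ultimately have "(\<Prod>i = 0..<l. A $$ (i, p i)) = 0"
        by (intro prod_zero) (auto intro!: bexI[of _ r])
      then show "signof p * (\<Prod>i = 0..<l. A $$ (i, p i)) = 0" by simp
    qed
  qed
  also have "\<dots> \<noteq> 0"
    using pat im[OF p0] by (auto simp: sign_def)
  finally show ?thesis .
qed

lemma principal_submatrix:
  assumes W: "W \<in> carrier_mat n n" and I: "I \<subseteq> {..<n}"
  shows "submatrix W I I \<in> carrier_mat (card I) (card I)"
    and "r < card I \<Longrightarrow> c < card I \<Longrightarrow> submatrix W I I $$ (r, c) = W $$ (pick I r, pick I c)"
proof -
  have *: "{i. i < n \<and> i \<in> I} = I" using I by auto
  show "submatrix W I I \<in> carrier_mat (card I) (card I)"
    using W * by (intro carrier_matI) (auto simp: dim_submatrix)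
  show "submatrix W I I $$ (r, c) = W $$ (pick I r, pick I c)" if "r < card I" "c < card I"
    using W * that by (subst submatrix_index) auto
qed

lemma det_submatrix_eq_0_of_sink:
  fixes W :: "'a :: comm_ring_1 mat"
  assumes W: "W \<in> carrier_mat n n" and I: "I \<subseteq> {..<n}" and i: "i \<in> I"
    and sink: "\<And>k. k \<in> I \<Longrightarrow> W $$ (i, k) = 0"
  shows "Determinant.det (submatrix W I I) = 0"
proof -
  have bij: "bij_betw (pick I) {..<card I} I"
    by (intro bij_betw_pick finite_subset[OF I]) simp
  then have "i \<in> pick I ` {..<card I}" using i by (simp add: bij_betw_def)
  then obtain r where r: "r < card I" "pick I r = i" by auto
  show ?thesis
  proof (rule det_zero_row[OF principal_submatrix(1)[OF W I] r(1)])
    fix c assume c: "c < card I"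
    then have "pick I c \<in> I" using bij by (auto simp: bij_betw_def)
    then show "submatrix W I I $$ (r, c) = 0"
      using principal_submatrix(2)[OF W I r(1) c] sink r(2) by simp
  qed
qed

text \<open>Minimality forces every successor function on \<open>I\<close> to be a bijection, since its image is again
sinkless.  Two distinct successors of one vertex would allow a successor function that is not
injective, so the submatrix has exactly one nonzero entry in each row, in the pattern of a permutation.\<close>
lemma minimal_sinkless_det:
  assumes W: "W \<in> carrier_mat n n" and S: "sinkless n W I"
    and min: "\<And>J. J \<subset> I \<Longrightarrow> \<not> sinkless n W J"
  shows "Determinant.det (submatrix W I I) \<noteq> 0"
proof -
  have I: "I \<subseteq> {..<n}" using S unfolding sinkless_def by blast
  then have fin: "finite I" by (rule finite_subset) simp
  \<comment> \<open>Surjective because the image is sinkless, hence not a proper subset; injective by finiteness.\<close>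
  have perm: "bij_betw \<sigma> I I" if \<sigma>: "\<And>i. i \<in> I \<Longrightarrow> \<sigma> i \<in> I \<and> W $$ (i, \<sigma> i) \<noteq> 0" for \<sigma>
  proof -
    have "sinkless n W (\<sigma> ` I)" using S \<sigma> unfolding sinkless_def by blast
    then have "\<sigma> ` I = I" using min[of "\<sigma> ` I"] \<sigma> by blast
    then show ?thesis using fin by (simp add: bij_betw_def finite_surj_inj)
  qed
  obtain \<sigma> where \<sigma>: "\<And>i. i \<in> I \<Longrightarrow> \<sigma> i \<in> I \<and> W $$ (i, \<sigma> i) \<noteq> 0"
    using S unfolding sinkless_def by metis
  have uniq: "k = \<sigma> i" if "i \<in> I" "k \<in> I" "W $$ (i, k) \<noteq> 0" for i k
  proof (rule ccontr)
    assume ne: "k \<noteq> \<sigma> i"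
    \<comment> \<open>The vertex that \<open>\<sigma>\<close> sends to \<open>k\<close> shares its image with \<open>i\<close> once \<open>\<sigma> i\<close> is redefined as \<open>k\<close>.\<close>
    obtain i' where i': "i' \<in> I" "\<sigma> i' = k"
      using perm[of \<sigma>] \<sigma> \<open>k \<in> I\<close> by (metis bij_betw_def imageE)
    have "bij_betw (\<sigma>(i := k)) I I" using \<sigma> that by (intro perm) auto
    then have "inj_on (\<sigma>(i := k)) I" by (simp add: bij_betw_def)
    then show False using i' ne \<open>i \<in> I\<close> by (auto simp: inj_on_def split: if_splits)
  qed
  have bij: "bij_betw (pick I) {..<card I} I" by (rule bij_betw_pick[OF fin])
  define h where "h = inv_into {..<card I} (pick I)"
  have h: "bij_betw h I {..<card I}" unfolding h_def by (rule bij_betw_inv_into[OF bij])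
  define p0 where "p0 r = (if r < card I then h (\<sigma> (pick I r)) else r)" for r
  have "bij_betw (h \<circ> \<sigma> \<circ> pick I) {..<card I} {..<card I}"
    using bij perm[of \<sigma>] \<sigma> h by (blast intro: bij_betw_trans)
  then have "bij_betw p0 {0..<card I} {0..<card I}"
    by (subst bij_betw_cong[of _ _ "h \<circ> \<sigma> \<circ> pick I"]) (auto simp: p0_def lessThan_atLeast0)
  then have p0: "p0 permutes {0..<card I}"
    by (intro bij_imp_permutes) (auto simp: p0_def)
  show ?thesis
  proof (rule det_permutation_pattern[OF principal_submatrix(1)[OF W I] p0])
    fix r c assume rc: "r < card I" "c < card I"
    then have in_I: "pick I r \<in> I" "pick I c \<in> I" using bij by (auto simp: bij_betw_def)
    have "submatrix W I I $$ (r, c) \<noteq> 0 \<longleftrightarrow> pick I c = \<sigma> (pick I r)"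
      using principal_submatrix(2)[OF W I rc] in_I \<sigma> uniq by metis
    also have "\<dots> \<longleftrightarrow> c = p0 r"
      using rc in_I \<sigma> bij unfolding p0_def h_def
      by (metis bij_betw_inv_into_left bij_betw_inv_into_right lessThan_iff)
    finally show "submatrix W I I $$ (r, c) \<noteq> 0 \<longleftrightarrow> c = p0 r" .
  qed
qed

lemma principal_minors_vanish_iff_sinkless:
  assumes W: "W \<in> carrier_mat n n"
  shows "principal_minors_vanish n W \<longleftrightarrow> (\<nexists>I. sinkless n W I)"
proof
  assume pm: "principal_minors_vanish n W"
  show "\<nexists>I. sinkless n W I"
  proof
    assume ex: "\<exists>I. sinkless n W I"
    then obtain I0 where I0: "sinkless n W I0" by blast
    \<comment> \<open>A sinkless set with the least number of elements is minimal for inclusion.\<close>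
    define I where "I = arg_min card (sinkless n W)"
    have S: "sinkless n W I" unfolding I_def by (rule arg_min_natI[of "sinkless n W" I0 card, OF I0])
    moreover have "\<not> sinkless n W J" if "J \<subset> I" for J
    proof
      assume "sinkless n W J"
      then have "card I \<le> card J" unfolding I_def by (rule arg_min_nat_le)
      moreover have "finite I" using S finite_subset[OF _ finite_lessThan] unfolding sinkless_def by blast
      ultimately show False using that psubset_card_mono[of I J] by simp
    qed
    ultimately have "Determinant.det (submatrix W I I) \<noteq> 0"
      by (rule minimal_sinkless_det[OF W])
    moreover have "I \<noteq> {} \<and> I \<subseteq> {..<n}" using S unfolding sinkless_def by blast
    ultimately show False using pm unfolding principal_minors_vanish_def by blast
  qed
next
  assume no: "\<nexists>I. sinkless n W I"
  show "principal_minors_vanish n W"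
    unfolding principal_minors_vanish_def
  proof (intro allI impI)
    fix I assume I: "I \<noteq> {} \<and> I \<subseteq> {..<n}"
    have "\<not> sinkless n W I" using no by simp
    then obtain i where "i \<in> I" "\<And>k. k \<in> I \<Longrightarrow> W $$ (i, k) = 0"
      using I unfolding sinkless_def by metis
    then show "Determinant.det (submatrix W I I) = 0"
      using I by (intro det_submatrix_eq_0_of_sink[OF W]) auto
  qed
qed

definition walk :: "nat \<Rightarrow> real mat \<Rightarrow> nat \<Rightarrow> (nat \<Rightarrow> nat) \<Rightarrow> bool" where
  "walk n W s f \<longleftrightarrow> (\<forall>i\<le>s. f i < n) \<and> (\<forall>i<s. W $$ (f i, f (Suc i)) \<noteq> 0)"

lemma walk_products_vanish_iff_walk:
  "walk_products_vanish n W \<longleftrightarrow> (\<nexists>f. walk n W n f)"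
proof
  assume v: "walk_products_vanish n W"
  show "\<nexists>f. walk n W n f"
  proof
    assume "\<exists>f. walk n W n f"
    then obtain f where f: "walk n W n f" by blast
    \<comment> \<open>The tuples are numbered from 1, walks from 0.\<close>
    have "\<forall>s\<in>{1..n + 1}. f (s - 1) < n" using f by (auto simp: walk_def)
    then have "(\<Prod>s=1..n. W $$ (f (s - 1), f (s + 1 - 1))) = 0"
      using v[unfolded walk_products_vanish_def, rule_format, of "\<lambda>s. f (s - 1)"] by simp
    then obtain s where s: "s \<in> {1..n}" "W $$ (f (s - 1), f s) = 0" by auto
    then have "s - 1 < n" "Suc (s - 1) = s" by auto
    then show False using f s(2) unfolding walk_def by metis
  qed
next
  assume nw: "\<nexists>f. walk n W n f"
  show "walk_products_vanish n W"
    unfolding walk_products_vanish_def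
  proof (intro allI impI)
    fix i :: "nat \<Rightarrow> nat" assume i: "\<forall>s\<in>{1..n + 1}. i s < n"
    have "\<not> walk n W n (\<lambda>s. i (s + 1))" using nw by blast
    then obtain s where "s < n" "W $$ (i (s + 1), i (Suc s + 1)) = 0"
      using i unfolding walk_def by auto
    then show "(\<Prod>s=1..n. W $$ (i s, i (s + 1))) = 0"
      by (intro prod_zero) (auto intro!: bexI[of _ "Suc s"])
  qed
qed

text \<open>Pigeonhole: among \<open>n + 1\<close> visited vertices two coincide, and the vertices of the walk between these
two visits form a closed walk.\<close>
lemma walk_n_imp_sinkless:
  assumes f: "walk n W n f"
  shows "\<exists>I. sinkless n W I"
proof -
  have "\<not> inj_on f {..n}"
  proof
    assume "inj_on f {..n}"
    moreover have "f ` {..n} \<subseteq> {..<n}" using f by (auto simp: walk_def)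
    ultimately have "card {..n} \<le> card {..<n}" by (metis card_inj_on_le finite_lessThan)
    then show False by simp
  qed
  then obtain i j where ij: "i < j" "j \<le> n" "f i = f j"
    unfolding inj_on_def by (metis atMost_iff linorder_neqE_nat)
  have "\<exists>k\<in>f ` {i..<j}. W $$ (f s, k) \<noteq> 0" if s: "s \<in> {i..<j}" for s
  proof -
    have "f (Suc s) \<in> f ` {i..<j}"
      using s ij by (cases "Suc s = j") (use image_eqI[of "f j" f i "{i..<j}"] in auto)
    moreover have "W $$ (f s, f (Suc s)) \<noteq> 0" using f s ij by (auto simp: walk_def)
    ultimately show ?thesis by blast
  qed
  then have "sinkless n W (f ` {i..<j})"
    using f ij unfolding sinkless_def walk_def by auto
  then show ?thesis by blast
qed

lemma sinkless_imp_walk: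
  assumes S: "sinkless n W I"
  shows "\<exists>f. walk n W s f"
proof -
  obtain \<sigma> where \<sigma>: "\<And>i. i \<in> I \<Longrightarrow> \<sigma> i \<in> I \<and> W $$ (i, \<sigma> i) \<noteq> 0"
    using S unfolding sinkless_def by metis
  obtain i0 where i0: "i0 \<in> I" using S unfolding sinkless_def by blast
  have it: "(\<sigma> ^^ k) i0 \<in> I" for k by (induction k) (use i0 \<sigma> in auto)
  have "walk n W s (\<lambda>k. (\<sigma> ^^ k) i0)"
    using it \<sigma> S unfolding walk_def sinkless_def by auto
  then show ?thesis by blast
qed

text \<open>The power is defined by multiplication on the right; walks and waves are extended at their
starting point, which corresponds to multiplication on the left.\<close>
lemma pow_mat_Suc_left_index:
  fixes W :: "real mat"
  assumes W: "W \<in> carrier_mat n n" and jk: "j < n" "k < n"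
  shows "(W ^\<^sub>m Suc s) $$ (j, k) = (\<Sum>i<n. W $$ (j, i) * (W ^\<^sub>m s) $$ (i, k))"
proof -
  have c: "W ^\<^sub>m t \<in> carrier_mat n n" for t
    using pow_mat_dim_square[OF W] by (intro carrier_matI) auto
  have "W ^\<^sub>m Suc s = W * W ^\<^sub>m s"
  proof (induction s)
    case 0 then show ?case using W by simp
  next
    case (Suc s)
    have "W ^\<^sub>m Suc (Suc s) = (W * W ^\<^sub>m s) * W" using Suc by simp
    also have "\<dots> = W * (W ^\<^sub>m s * W)" by (rule assoc_mult_mat[OF W c W])
    finally show ?case by simp
  qed
  then show ?thesis using W jk c[of s]
    by (simp add: scalar_prod_def lessThan_atLeast0)
qed

lemma pow_mat_nonneg:
  fixes W :: "real mat"
  assumes W: "W \<in> carrier_mat n n" and nn: "\<And>i j. i < n \<Longrightarrow> j < n \<Longrightarrow> W $$ (i, j) \<ge> 0"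
  shows "j < n \<Longrightarrow> k < n \<Longrightarrow> (W ^\<^sub>m s) $$ (j, k) \<ge> 0"
proof (induction s arbitrary: j)
  case 0 then show ?case using W by simp
next
  case (Suc s) then show ?case using W nn
    unfolding pow_mat_Suc_left_index[OF W Suc.prems]
    by (intro sum_nonneg mult_nonneg_nonneg) auto
qed

text \<open>Nonnegativity excludes cancellation between different walks with the same end points.\<close>
lemma walk_imp_pow_mat_pos:
  fixes W :: "real mat"
  assumes W: "W \<in> carrier_mat n n" and nn: "\<And>i j. i < n \<Longrightarrow> j < n \<Longrightarrow> W $$ (i, j) \<ge> 0"
  shows "walk n W s f \<Longrightarrow> (W ^\<^sub>m s) $$ (f 0, f s) > 0"
proof (induction s arbitrary: f)
  case 0 then show ?case using W by (simp add: walk_def)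
next
  case (Suc s)
  have lt: "f 0 < n" "f 1 < n" "f (Suc s) < n" using Suc.prems by (auto simp: walk_def)
  have "walk n W s (\<lambda>i. f (Suc i))" using Suc.prems by (auto simp: walk_def)
  from Suc.IH[OF this] have pos: "(W ^\<^sub>m s) $$ (f 1, f (Suc s)) > 0" by simp
  have "W $$ (f 0, f 1) \<noteq> 0" using Suc.prems by (auto simp: walk_def)
  then have "W $$ (f 0, f 1) > 0" using nn[OF lt(1,2)] by simp
  with pos have "0 < W $$ (f 0, f 1) * (W ^\<^sub>m s) $$ (f 1, f (Suc s))" by simp
  also have "\<dots> \<le> (\<Sum>i<n. W $$ (f 0, i) * (W ^\<^sub>m s) $$ (i, f (Suc s)))"
    using lt nn pow_mat_nonneg[OF W nn]
    by (intro member_le_sum) auto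
  finally show ?case unfolding pow_mat_Suc_left_index[OF W lt(1,3)] .
qed

lemma pow_mat_nonzero_imp_walk:
  fixes W :: "real mat"
  assumes W: "W \<in> carrier_mat n n"
  shows "j < n \<Longrightarrow> k < n \<Longrightarrow> (W ^\<^sub>m s) $$ (j, k) \<noteq> 0 \<Longrightarrow> \<exists>f. walk n W s f \<and> f 0 = j"
proof (induction s arbitrary: j)
  case 0 then show ?case by (auto simp: walk_def intro!: exI[of _ "\<lambda>_. j"])
next
  case (Suc s)
  from Suc.prems(3) obtain i where i: "i < n" "W $$ (j, i) \<noteq> 0" "(W ^\<^sub>m s) $$ (i, k) \<noteq> 0"
    unfolding pow_mat_Suc_left_index[OF W Suc.prems(1,2)]
    by (metis (no_types, lifting) lessThan_iff mult_eq_0_iff sum.neutral)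
  from Suc.IH[OF i(1) Suc.prems(2) i(3)] obtain f where f: "walk n W s f" "f 0 = i" by blast
  have "walk n W (Suc s) (case_nat j f)"
    using f i Suc.prems unfolding walk_def by (auto split: nat.split simp: less_Suc_eq_0_disj)
  then show ?case by (auto intro!: exI[of _ "case_nat j f"])
qed

lemma walk_products_vanish_iff_sinkless:
  "walk_products_vanish n W \<longleftrightarrow> (\<nexists>I. sinkless n W I)"
  unfolding walk_products_vanish_iff_walk
  using walk_n_imp_sinkless sinkless_imp_walk by blast

lemma pow_mat_eq_0_iff_sinkless:
  fixes W :: "real mat"
  assumes W: "W \<in> carrier_mat n n" and nn: "\<And>i j. i < n \<Longrightarrow> j < n \<Longrightarrow> W $$ (i, j) \<ge> 0"
  shows "W ^\<^sub>m n = 0\<^sub>m n n \<longleftrightarrow> (\<nexists>I. sinkless n W I)"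
proof
  assume z: "W ^\<^sub>m n = 0\<^sub>m n n"
  show "\<nexists>I. sinkless n W I"
  proof
    assume "\<exists>I. sinkless n W I"
    then obtain f where f: "walk n W n f" using sinkless_imp_walk by blast
    with walk_imp_pow_mat_pos[OF W nn f] show False by (simp add: z walk_def)
  qed
next
  assume "\<nexists>I. sinkless n W I"
  then have "\<nexists>f. walk n W n f" using walk_n_imp_sinkless by blast
  then have "(W ^\<^sub>m n) $$ (j, k) = 0" if "j < n" "k < n" for j k
    using pow_mat_nonzero_imp_walk[OF W that] by blast
  then show "W ^\<^sub>m n = 0\<^sub>m n n"
    using W by (intro eq_matI) auto
qed

section \<open>Extinction of classical solutions\<close>

text \<open>Continuity of the partial derivatives gives the total derivative, which is needed to differentiate a
solution along a characteristic direction.\<close>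
lemma C1_strip_has_derivative_interior:
  assumes C1: "C1_strip f fx ft" and x: "0 < x" "x < 1" and t: "0 < t"
  shows "((\<lambda>(x, t). f x t) has_derivative (\<lambda>(h, k). fx x t * h + ft x t * k)) (at (x, t))"
proof -
  define I :: "real set" where "I = {0<..<1}"
  define J :: "real set" where "J = {0<..}"
  have dx: "((\<lambda>x. f x t) has_derivative (*) (fx x t)) (at x within I)"
    using C1 x t unfolding C1_strip_def has_field_derivative_def I_def
    by (force intro: has_derivative_subset[where s = "{0..1}"])
  have dt: "((\<lambda>t. f x t) has_derivative blinfun_apply (blinfun_scaleR_right (ft x t))) (at t within J)"
    if "x \<in> I" "t \<in> J" for x t
  proof -
    have "((\<lambda>t. f x t) has_real_derivative ft x t) (at t within {0..})"
      using C1 that unfolding C1_strip_def I_def J_def by auto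
    then have "((\<lambda>t. f x t) has_derivative (*) (ft x t)) (at t within J)"
      unfolding has_field_derivative_def J_def by (rule has_derivative_subset) auto
    moreover have "(*) (ft x t) = blinfun_apply (blinfun_scaleR_right (ft x t))"
      by (auto simp: fun_eq_iff)
    ultimately show ?thesis by simp
  qed
  have op: "open (I \<times> J)" unfolding I_def J_def by (intro open_Times) auto
  have xt: "(x, t) \<in> I \<times> J" using x t by (auto simp: I_def J_def)
  have "continuous_on strip (\<lambda>(x, t). ft x t)" using C1 by (simp add: C1_strip_def)
  then have "continuous_on (I \<times> J) (\<lambda>(x, t). ft x t)"
    by (rule continuous_on_subset) (auto simp: I_def J_def strip_def)
  then have "continuous_on (I \<times> J) (\<lambda>z. blinfun_scaleR_right (ft (fst z) (snd z)))"
    by (intro bounded_linear.continuous_on[OF bounded_linear_blinfun_scaleR_right]) (simp add: case_prod_unfold)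
  then have ct: "continuous (at (x, t) within I \<times> J) (\<lambda>(x, t). blinfun_scaleR_right (ft x t))"
    using xt unfolding continuous_on_eq_continuous_within case_prod_unfold by blast
  have "((\<lambda>(x, t). f x t) has_derivative (\<lambda>(h, k). fx x t * h + blinfun_scaleR_right (ft x t) k)) (at (x, t) within I \<times> J)"
    using has_derivative_partialsI[OF dx dt ct] xt by (auto simp: J_def)
  then show ?thesis using at_within_open[OF xt op] by simp
qed

text \<open>A maximum principle for \<open>w (y, s) = (v y s)\<^sup>2 exp (- L s)\<close> on the triangle where
\<open>y \<le> a0 (s - T)\<close>.  From a point with \<open>y > 0\<close>, a short step back in time along the characteristic
direction stays in the triangle, because the speed is at least \<open>a0\<close>.  For large \<open>L\<close> the function
\<open>w\<close> strictly increases in this direction wherever it is positive, so a positive maximum is impossible.\<close>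
lemma zero_below_slow_line:
  assumes C1: "C1_strip v vx vt"
    and pde: "\<And>x t. 0 < x \<Longrightarrow> x < 1 \<Longrightarrow> 0 < t \<Longrightarrow> vt x t + A x t * vx x t + B x t * v x t = 0"
    and a0: "a0 > 0" and A: "\<And>x t. 0 < x \<Longrightarrow> x < 1 \<Longrightarrow> 0 < t \<Longrightarrow> A x t \<ge> a0"
    and B: "\<And>x t. 0 < x \<Longrightarrow> x < 1 \<Longrightarrow> 0 < t \<Longrightarrow> \<bar>B x t\<bar> \<le> C"
    and T: "T \<ge> 0" and inflow: "\<And>t. t \<ge> T \<Longrightarrow> v 0 t = 0"
    and x: "0 \<le> x" "x < 1" and t: "t \<ge> T + x / a0"
  shows "v x t = 0"
proof -
  \<comment> \<open>Large enough to make \<open>2 B + L\<close> at least 1, whatever the sign of \<open>B\<close>.\<close>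
  define L where "L = 2 * C + 1"
  define w where "w = (\<lambda>(y, s). (v y s)\<^sup>2 * exp (- L * s))"
  define R where "R = {(y, s). 0 \<le> y \<and> y \<le> x \<and> T + y / a0 \<le> s \<and> s \<le> t}"
  have R_box: "R \<subseteq> {0..x} \<times> {T..t}"
  proof clarify
    fix y s assume "(y, s) \<in> R"
    then have "0 \<le> y" "y \<le> x" "T + y / a0 \<le> s" "s \<le> t" by (auto simp: R_def)
    moreover from this have "0 \<le> y / a0" using a0 by simp
    ultimately show "y \<in> {0..x} \<and> s \<in> {T..t}" by simp
  qed
  have "closed R"
    unfolding R_def case_prod_unfold using a0
    by (intro closed_Collect_conj closed_Collect_le continuous_intros) auto
  moreover have "bounded R"
    using bounded_subset[OF bounded_Times[OF bounded_closed_interval bounded_closed_interval] R_box] .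
  ultimately have "compact R" by (simp add: compact_eq_bounded_closed)
  have xt: "(x, t) \<in> R" using x t by (auto simp: R_def)
  have R_strip: "R \<subseteq> strip" using R_box x T by (auto simp: strip_def)
  have "continuous_on R (\<lambda>(y, s). v y s)"
    using C1 R_strip continuous_on_subset by (auto simp: C1_strip_def)
  then have "continuous_on R w"
    unfolding w_def case_prod_unfold by (intro continuous_intros)
  then obtain z where z: "z \<in> R" and max: "\<And>z'. z' \<in> R \<Longrightarrow> w z' \<le> w z"
    using continuous_attains_sup[OF \<open>compact R\<close>] xt by blast
  obtain y s where ys: "z = (y, s)" by fastforce
  have "w z \<le> 0"
  proof (rule ccontr)
    assume "\<not> w z \<le> 0"
    then have vnz: "v y s \<noteq> 0" by (auto simp: w_def ys)
    have R: "0 \<le> y" "y \<le> x" "T + y / a0 \<le> s" "s \<le> t" using z by (auto simp: R_def ys)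
    have "y \<noteq> 0" using inflow[of s] R vnz by auto
    with R have y: "0 < y" by simp
    have y1: "y < 1" using R x by simp
    have "0 < y / a0" using y a0 by simp
    then have s: "0 < s" using R T by linarith
    define \<alpha> where "\<alpha> = A y s"
    have \<alpha>: "\<alpha> \<ge> a0" unfolding \<alpha>_def using A y y1 s by simp
    \<comment> \<open>The path leaves the maximum point along the backward characteristic direction.\<close>
    define g where "g h = w (y - \<alpha> * h, s - h)" for h
    have v_path: "((\<lambda>h. v (y - \<alpha> * h) (s - h)) has_real_derivative (B y s * v y s)) (at 0)"
    proof -
      have "((\<lambda>h. (y - \<alpha> * h, s - h)) has_derivative (\<lambda>h. (- \<alpha> * h, - h))) (at 0)"
        by (auto intro!: derivative_eq_intros)
      moreover have "((\<lambda>(x, t). v x t) has_derivative (\<lambda>(h, k). vx y s * h + vt y s * k))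
          (at (y - \<alpha> * 0, s - 0))"
        using C1_strip_has_derivative_interior[OF C1 y y1 s] by simp
      ultimately have "((\<lambda>z. (\<lambda>(x, t). v x t) ((\<lambda>h. (y - \<alpha> * h, s - h)) z)) has_derivative
          (\<lambda>z. (\<lambda>(h, k). vx y s * h + vt y s * k) ((\<lambda>h. (- \<alpha> * h, - h)) z))) (at 0)"
        by (rule has_derivative_compose)
      moreover have "vt y s + \<alpha> * vx y s + B y s * v y s = 0"
        unfolding \<alpha>_def using pde y y1 s by simp
      then have eq: "B y s * v y s = - (\<alpha> * vx y s) - vt y s" by simp
      have "(\<lambda>z. (\<lambda>(h, k). vx y s * h + vt y s * k) ((\<lambda>h. (- \<alpha> * h, - h)) z)) = (*) (B y s * v y s)"
        unfolding eq by (auto simp: fun_eq_iff algebra_simps)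
      ultimately show ?thesis by (simp add: has_field_derivative_def)
    qed
    have "(g has_real_derivative (v y s)\<^sup>2 * (2 * B y s + L) * exp (- L * s)) (at 0)"
      unfolding g_def w_def prod.case
      by (rule derivative_eq_intros v_path refl)+ (simp add: algebra_simps power2_eq_square)
    moreover have "(v y s)\<^sup>2 * (2 * B y s + L) * exp (- L * s) > 0"
      using vnz B[OF y y1 s] by (simp add: L_def)
    ultimately obtain d where d: "d > 0" "\<And>h. 0 < h \<Longrightarrow> h < d \<Longrightarrow> g 0 < g h"
      using DERIV_pos_inc_right[of g _ 0] by auto
    \<comment> \<open>The second bound keeps the path to the right of the line \<open>x = 0\<close>.\<close>
    define h where "h = min (d / 2) (y / \<alpha>)"
    have "\<alpha> > 0" using \<alpha> a0 by simp
    have "h \<le> d / 2" unfolding h_def by (rule min.cobounded1)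
    then have h: "0 < h" "h < d" "h \<le> y / \<alpha>" using d y \<open>\<alpha> > 0\<close> by (auto simp: h_def)
    have "\<alpha> * h \<le> y" using h(3) \<open>\<alpha> > 0\<close> by (simp add: field_simps)
    moreover have "a0 * h \<le> \<alpha> * h" using \<alpha> h by simp
    then have "h \<le> \<alpha> * h / a0" using a0 by (simp add: field_simps)
    moreover have "0 \<le> \<alpha> * h" using \<open>\<alpha> > 0\<close> h by simp
    ultimately have "(y - \<alpha> * h, s - h) \<in> R"
      using R h by (simp add: R_def diff_divide_distrib)
    from max[OF this] d(2)[OF h(1,2)] show False by (simp add: g_def ys)
  qed
  then have "w (x, t) \<le> 0" using max[OF xt] by simp
  then have "(v x t)\<^sup>2 \<le> 0" by (simp add: w_def mult_le_0_iff)
  then show ?thesis by simp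
qed

text \<open>The endpoint \<open>x = 1\<close>, where the equation is not assumed, is reached by continuity in \<open>x\<close>.\<close>
lemma zero_after_crossing_time:
  assumes C1: "C1_strip v vx vt"
    and pde: "\<And>x t. 0 < x \<Longrightarrow> x < 1 \<Longrightarrow> 0 < t \<Longrightarrow> vt x t + A x t * vx x t + B x t * v x t = 0"
    and a0: "a0 > 0" and A: "\<And>x t. 0 < x \<Longrightarrow> x < 1 \<Longrightarrow> 0 < t \<Longrightarrow> A x t \<ge> a0"
    and B: "\<And>x t. 0 < x \<Longrightarrow> x < 1 \<Longrightarrow> 0 < t \<Longrightarrow> \<bar>B x t\<bar> \<le> C"
    and T: "T \<ge> 0" and inflow: "\<And>t. t \<ge> T \<Longrightarrow> v 0 t = 0"
    and x: "x \<in> {0..1}" and t: "t \<ge> T + 1 / a0"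
  shows "v x t = 0"
proof -
  have "0 < 1 / a0" using a0 by simp
  then have "t \<ge> 0" using t T by linarith
  then have "\<forall>y\<in>{0..1}. ((\<lambda>y. v y t) has_real_derivative vx y t) (at y within {0..1})"
    using C1 by (auto simp: C1_strip_def)
  then have "continuous_on (closure {0..<1}) (\<lambda>y. v y t)"
    by (auto intro!: DERIV_continuous_on)
  moreover have "v y t = 0" if "y \<in> {0..<1}" for y
  proof (rule zero_below_slow_line[OF C1 pde a0 A B T inflow])
    have "y / a0 \<le> 1 / a0" using that a0 by (simp add: divide_right_mono)
    then show "t \<ge> T + y / a0" using t by simp
  qed (use that in auto)
  ultimately show ?thesis
    using x continuous_constant_on_closure[of "{0..<1}" "\<lambda>y. v y t" 0 x] by auto
qed

lemma has_real_derivative_reflect_01: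
  fixes f :: "real \<Rightarrow> real"
  assumes "(f has_real_derivative D) (at (1 - x) within {0..1})"
  shows "((\<lambda>y. f (1 - y)) has_real_derivative - D) (at x within {0..1})"
proof -
  have im: "(\<lambda>y::real. 1 - y) ` {0..1} = {0..1}"
    by (auto intro!: image_eqI[of _ _ "1 - _"])
  have "(f has_real_derivative D) (at (1 - x) within (\<lambda>y. 1 - y) ` {0..1})"
    unfolding im by (rule assms)
  moreover have "((\<lambda>y. 1 - y) has_real_derivative -1) (at x within {0..1})"
    by (auto intro!: derivative_eq_intros)
  ultimately show ?thesis using DERIV_image_chain by (fastforce simp: o_def)
qed

text \<open>Reflection turns leftward components into rightward ones, so that the previous lemma
applies to all of them.\<close>
lemma C1_strip_reflect:
  assumes C1: "C1_strip f fx ft"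
  shows "C1_strip (\<lambda>x t. f (1 - x) t) (\<lambda>x t. - fx (1 - x) t) (\<lambda>x t. ft (1 - x) t)"
proof -
  have cont: "continuous_on strip (\<lambda>(x, t). h (1 - x) t)" if "continuous_on strip (\<lambda>(x, t). h x t)"
    for h :: "real \<Rightarrow> real \<Rightarrow> real"
  proof -
    have "continuous_on strip ((\<lambda>(x, t). h x t) \<circ> (\<lambda>z. (1 - fst z, snd z)))"
      by (intro continuous_on_compose continuous_intros continuous_on_subset[OF that])
         (auto simp: strip_def)
    then show ?thesis by (simp add: case_prod_unfold o_def)
  qed
  have dx: "((\<lambda>y. f (1 - y) t) has_real_derivative - fx (1 - x) t) (at x within {0..1})"
    if "x \<in> {0..1}" "t \<in> {0..}" for x t
  proof -
    have "((\<lambda>y. f y t) has_real_derivative fx (1 - x) t) (at (1 - x) within {0..1})"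
      using C1 that by (auto simp: C1_strip_def)
    then show ?thesis by (rule has_real_derivative_reflect_01)
  qed
  show ?thesis
    using C1 dx cont[of f] cont[of ft] continuous_on_minus[OF cont[of fx]]
    unfolding C1_strip_def by (auto simp: case_prod_unfold)
qed

text \<open>A zero row \<open>j\<close> in \<open>W ^\<^sub>m s\<close> means that no walk of length \<open>s\<close> starts at \<open>j\<close>.  Then the successors of \<open>j\<close>
start no walk of length \<open>s - 1\<close> and have died out one crossing time earlier, which
switches off the inflow of \<open>u j\<close>.\<close>
lemma classical_solution_vanishes:
  fixes W :: "real mat"
  assumes W: "W \<in> carrier_mat n n" and nn: "\<And>i j. i < n \<Longrightarrow> j < n \<Longrightarrow> W $$ (i, j) \<ge> 0"
    and m: "m \<le> n"
    and sol: "classical_solution n m a b (\<lambda>j k t. q j k t * W $$ (j, k)) \<phi> u"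
    and adm: "\<And>j. j < n \<Longrightarrow> C1_bounded_strip (b j)"
    and a0: "a0 > 0"
    and speed: "\<forall>x\<in>{0..1}. \<forall>t\<in>{0..}. (\<forall>j<m. a j x t \<ge> a0) \<and> (\<forall>j\<in>{m..<n}. a j x t \<le> - a0)"
  shows "j < n \<Longrightarrow> (\<forall>k<n. (W ^\<^sub>m s) $$ (j, k) = 0) \<Longrightarrow> x \<in> {0..1} \<Longrightarrow> t \<ge> real s / a0 \<Longrightarrow> u j x t = 0"
proof (induction s arbitrary: j x t)
  case 0
  then show ?case using W by force
next
  case (Suc s)
  note j = \<open>j < n\<close>
  define T where "T = real s / a0"
  have T: "T \<ge> 0" using a0 by (simp add: T_def)
  have t: "t \<ge> T + 1 / a0" using Suc.prems(4) by (simp add: T_def add_divide_distrib add.commute)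
  have upstream: "W $$ (j, k) = 0 \<or> (\<forall>y\<in>{0..1}. u k y r = 0)" if k: "k < n" and r: "r \<ge> T" for k r
  proof (cases "W $$ (j, k) = 0")
    case False
    have "(W ^\<^sub>m s) $$ (k, l) = 0" if l: "l < n" for l
    proof -
      have "(\<Sum>i<n. W $$ (j, i) * (W ^\<^sub>m s) $$ (i, l)) = 0"
        using Suc.prems(2) l unfolding pow_mat_Suc_left_index[OF W j l, symmetric] by blast
      then have "W $$ (j, k) * (W ^\<^sub>m s) $$ (k, l) = 0"
        using k j l nn pow_mat_nonneg[OF W nn] by (subst (asm) sum_nonneg_eq_0_iff) auto
      with False show ?thesis by simp
    qed
    then show ?thesis using Suc.IH[OF k] r by (auto simp: T_def)
  qed simp
  have rhs: "boundary_rhs n m (\<lambda>j k t. q j k t * W $$ (j, k)) u j r = 0" if r: "r \<ge> T" for r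
  proof -
    have "q j k r * W $$ (j, k) * u k y r = 0" if "k < n" "y \<in> {0, 1}" for k y
      using upstream[OF that(1) r] that(2) by auto
    then have "(\<Sum>k<m. q j k r * W $$ (j, k) * u k 1 r) = 0"
      and "(\<Sum>k=m..<n. q j k r * W $$ (j, k) * u k 0 r) = 0"
      using m by (auto intro!: sum.neutral)
    then show ?thesis unfolding boundary_rhs_def by simp
  qed
  obtain ux ut where C1: "C1_strip (u j) ux ut"
    and pde: "\<And>x t. 0 < x \<Longrightarrow> x < 1 \<Longrightarrow> 0 < t \<Longrightarrow> ut x t + a j x t * ux x t + b j x t * u j x t = 0"
    using sol j unfolding classical_solution_def by metis
  obtain C where C: "\<And>x t. x \<in> {0..1} \<Longrightarrow> t \<in> {0..} \<Longrightarrow> \<bar>b j x t\<bar> \<le> C"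
    using adm[OF j] unfolding C1_bounded_strip_def by metis
  show ?case
  proof (cases "j < m")
    case True
    show ?thesis
    proof (rule zero_after_crossing_time[OF C1 pde a0 _ _ T _ \<open>x \<in> {0..1}\<close> t, where C = C])
      show "u j 0 r = 0" if "r \<ge> T" for r
        using sol True rhs[OF that] T that unfolding classical_solution_def by auto
    qed (use speed True C in auto)
  next
    case False
    have "u j (1 - (1 - x)) t = 0"
    proof (rule zero_after_crossing_time[OF C1_strip_reflect[OF C1] _ a0, where A = "\<lambda>x t. - a j (1 - x) t"
          and B = "\<lambda>x t. b j (1 - x) t" and T = T and C = C])
      show "u j (1 - 0) r = 0" if "r \<ge> T" for r
        using sol False j rhs[OF that] T that unfolding classical_solution_def by auto
      show "ut (1 - x) t + - a j (1 - x) t * - ux (1 - x) t + b j (1 - x) t * u j (1 - x) t = 0"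
        if "0 < x" "x < 1" "0 < t" for x t
        using pde[of "1 - x" t] that by simp
      show "a0 \<le> - a j (1 - x) t" if "0 < x" "x < 1" "0 < t" for x t
      proof -
        have "\<forall>j\<in>{m..<n}. a j (1 - x) t \<le> - a0" using speed that by auto
        moreover have "j \<in> {m..<n}" using False j by simp
        ultimately show ?thesis by fastforce
      qed
    qed (use C T t a0 \<open>x \<in> {0..1}\<close> in auto)
    then show ?thesis by simp
  qed
qed

section \<open>Density of the test functions in the space of square integrable functions\<close>

text \<open>Up to the polynomial and the power in front, this is the standard smooth bump supported in \<open>[a, b]\<close>.
The two extra parameters \<open>P\<close> and \<open>k\<close> make the family closed under differentiation, and \<open>P\<close> also serves
to approximate arbitrary functions.\<close>
definition flat_bump :: "real \<Rightarrow> real \<Rightarrow> real \<Rightarrow> real poly \<Rightarrow> nat \<Rightarrow> real \<Rightarrow> real" where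
  "flat_bump a b c P k x =
     (if a < x \<and> x < b
      then poly P x / ((x - a) * (b - x)) ^ k * exp (- c / ((x - a) * (b - x))) else 0)"

text \<open>With \<open>Q = (x - a) (b - x)\<close> and \<open>S = Q'\<close>, the derivative of \<open>P Q\<^sup>-\<^sup>k exp (- c / Q)\<close> has the same form,
with \<open>k + 2\<close> instead of \<open>k\<close> and this polynomial instead of \<open>P\<close>.\<close>
definition flat_bump_next :: "real \<Rightarrow> real \<Rightarrow> real \<Rightarrow> nat \<Rightarrow> real poly \<Rightarrow> real poly" where
  "flat_bump_next a b c k P =
     (let Q = [:-a, 1:] * [:b, -1:]; S = [:a + b, -2:]
      in pderiv P * Q\<^sup>2 - of_nat k * P * S * Q + [:c:] * (P * S))"

lemma power_mult_exp_bound: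
  fixes y c :: real
  assumes c: "c > 0" and y: "y \<ge> 0" and k: "k > 0"
  shows "y ^ k * exp (- c * y) \<le> (real k / c) ^ k"
proof -
  have "c * y / real k \<le> exp (c * y / real k)"
    using exp_ge_add_one_self[of "c * y / real k"] by linarith
  then have "(c * y / real k) ^ k \<le> exp (c * y / real k) ^ k"
    using c y k by (intro power_mono) auto
  also have "\<dots> = exp (c * y)" using k by (simp flip: exp_of_nat_mult)
  finally have "(c * y / real k) ^ k * (real k / c) ^ k \<le> exp (c * y) * (real k / c) ^ k"
    using c by (intro mult_right_mono) auto
  moreover have "(c * y / real k) ^ k * (real k / c) ^ k = y ^ k"
    using c k by (simp flip: power_mult_distrib)
  ultimately have "y ^ k * exp (- c * y) \<le> exp (c * y) * (real k / c) ^ k * exp (- c * y)"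
    by (intro mult_right_mono) auto
  also have "\<dots> = (real k / c) ^ k" by (simp add: mult_ac flip: exp_add)
  finally show ?thesis .
qed

lemma has_derivative_0_of_quadratic_bound:
  fixes f :: "real \<Rightarrow> real"
  assumes bound: "\<And>x. \<bar>f x\<bar> \<le> K * (x - p)\<^sup>2"
  shows "(f has_real_derivative 0) (at p)"
proof -
  have fp: "f p = 0" using bound[of p] by simp
  have "((\<lambda>x. (f x - f p) / (x - p)) \<longlongrightarrow> 0) (at p)"
  proof (rule Lim_null_comparison)
    show "\<forall>\<^sub>F x in at p. norm ((f x - f p) / (x - p)) \<le> K * \<bar>x - p\<bar>"
      unfolding eventually_at_filter
    proof (intro always_eventually allI impI)
      fix x assume "x \<noteq> p"
      then have "\<bar>f x\<bar> / \<bar>x - p\<bar> \<le> K * (x - p)\<^sup>2 / \<bar>x - p\<bar>"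
        by (intro divide_right_mono bound) auto
      also have "(x - p)\<^sup>2 = \<bar>x - p\<bar> * \<bar>x - p\<bar>" by (simp add: power2_eq_square)
      also have "K * (\<bar>x - p\<bar> * \<bar>x - p\<bar>) / \<bar>x - p\<bar> = K * \<bar>x - p\<bar>"
        using \<open>x \<noteq> p\<close> by (simp del: abs_mult_self_eq)
      finally show "norm ((f x - f p) / (x - p)) \<le> K * \<bar>x - p\<bar>" by (simp add: fp)
    qed
    show "((\<lambda>x. K * \<bar>x - p\<bar>) \<longlongrightarrow> 0) (at p)"
      by (auto intro!: tendsto_eq_intros)
  qed
  then show ?thesis by (simp add: has_field_derivative_iff)
qed

text \<open>The factor \<open>exp (- c / Q)\<close> absorbs any negative power of \<open>Q\<close> and leaves \<open>Q\<^sup>2\<close>, and \<open>Q\<close> itself is at most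
\<open>b - a\<close> times the distance to any point outside \<open>(a, b)\<close>.  This yields flatness at all these
points at once, including the two critical points \<open>a\<close> and \<open>b\<close>.\<close>
lemma flat_bump_bound:
  assumes c: "c > 0"
  obtains K where "\<And>p x. \<not> (a < p \<and> p < b) \<Longrightarrow> \<bar>flat_bump a b c P k x\<bar> \<le> K * (x - p)\<^sup>2"
proof -
  define q where "q = (\<lambda>x. (x - a) * (b - x))"
  have "compact (poly P ` {a..b})"
    by (intro compact_continuous_image continuous_intros) auto
  then obtain B where B: "\<And>x. x \<in> {a..b} \<Longrightarrow> \<bar>poly P x\<bar> \<le> B"
    using compact_imp_bounded bounded_iff by (metis image_eqI real_norm_def)
  \<comment> \<open>The power \<open>k + 2\<close> leaves the factor \<open>Q\<^sup>2\<close> after compensating the \<open>k\<close>-th power in the denominator.\<close>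
  define M where "M = (real (k + 2) / c) ^ (k + 2)"
  have M: "M \<ge> 0" using c by (simp add: M_def)
  show thesis
  proof (rule that)
    fix p x :: real assume p: "\<not> (a < p \<and> p < b)"
    show "\<bar>flat_bump a b c P k x\<bar> \<le> \<bar>B\<bar> * M * (b - a)\<^sup>2 * (x - p)\<^sup>2"
    proof (cases "a < x \<and> x < b")
      case True
      then have q0: "q x > 0" by (simp add: q_def)
      have "q x \<le> (b - a) * \<bar>x - p\<bar>"
      proof (cases "p \<le> a")
        case p: True
        have "q x \<le> (x - p) * (b - a)"
          unfolding q_def using True p by (intro mult_mono) auto
        then show ?thesis using True p by (simp add: mult.commute)
      next
        case False
        then have pb: "p \<ge> b" using p by simp
        have "q x \<le> (b - a) * (p - x)"
          unfolding q_def using True pb by (intro mult_mono) auto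
        then show ?thesis using True pb by simp
      qed
      then have "(q x)\<^sup>2 \<le> ((b - a) * \<bar>x - p\<bar>)\<^sup>2" using q0 by (intro power_mono) auto
      then have q2: "(q x)\<^sup>2 \<le> (b - a)\<^sup>2 * (x - p)\<^sup>2" by (simp add: power_mult_distrib)
      have "\<bar>flat_bump a b c P k x\<bar> = \<bar>poly P x\<bar> * ((q x)\<^sup>2 * ((1 / q x) ^ (k + 2) * exp (- c * (1 / q x))))"
        using True q0 unfolding flat_bump_def q_def
        by (simp add: abs_mult power_divide power_add power2_eq_square)
      also have "\<dots> \<le> \<bar>B\<bar> * (((b - a)\<^sup>2 * (x - p)\<^sup>2) * M)"
      proof (intro mult_mono q2)
        show "\<bar>poly P x\<bar> \<le> \<bar>B\<bar>" using B[of x] True by auto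
        show "(1 / q x) ^ (k + 2) * exp (- c * (1 / q x)) \<le> M"
          unfolding M_def using c q0 by (intro power_mult_exp_bound) auto
      qed (use q0 in auto)
      finally show ?thesis by (simp add: mult_ac)
    next
      case False
      then show ?thesis using M by (auto simp: flat_bump_def)
    qed
  qed
qed

lemma flat_bump_has_derivative:
  assumes c: "c > 0"
  shows "(flat_bump a b c P k has_real_derivative
           flat_bump a b c (flat_bump_next a b c k P) (k + 2) x) (at x)"
proof (cases "a < x \<and> x < b")
  case False
  obtain K where "\<And>p x. \<not> (a < p \<and> p < b) \<Longrightarrow> \<bar>flat_bump a b c P k x\<bar> \<le> K * (x - p)\<^sup>2"
    using flat_bump_bound[OF c] by blast
  from has_derivative_0_of_quadratic_bound[OF this[OF False]]
  have "(flat_bump a b c P k has_real_derivative 0) (at x)" .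
  moreover have "flat_bump a b c (flat_bump_next a b c k P) (k + 2) x = 0"
    using False by (simp only: flat_bump_def if_False)
  ultimately show ?thesis by simp
next
  case True
  define q where "q = (\<lambda>x. (x - a) * (b - x))"
  have q0: "q x > 0" using True by (simp add: q_def)
  have q': "(q has_real_derivative (a + b - 2 * x)) (at x)"
    unfolding q_def by (auto intro!: derivative_eq_intros simp: algebra_simps)
  have "((\<lambda>x. poly P x / q x ^ k * exp (- c / q x)) has_real_derivative
      (poly (pderiv P) x * (q x ^ k) - poly P x * (real k * q x ^ (k - 1) * (a + b - 2 * x))) /
        (q x ^ k * q x ^ k) * exp (- c / q x)
      + exp (- c / q x) * (c * (a + b - 2 * x) / (q x * q x)) * (poly P x / q x ^ k)) (at x)"
    using q0
    by (auto intro!: derivative_eq_intros q' poly_DERIV simp: field_simps)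
  also have "(poly (pderiv P) x * (q x ^ k) - poly P x * (real k * q x ^ (k - 1) * (a + b - 2 * x))) /
        (q x ^ k * q x ^ k) * exp (- c / q x)
      + exp (- c / q x) * (c * (a + b - 2 * x) / (q x * q x)) * (poly P x / q x ^ k)
      = (poly (pderiv P) x * (q x)\<^sup>2 - real k * poly P x * (a + b - 2 * x) * q x + c * (poly P x * (a + b - 2 * x)))
        / q x ^ (k + 2) * exp (- c / q x)"
    using q0 by (cases k) (simp_all add: field_simps power2_eq_square)
  also have "\<dots> = flat_bump a b c (flat_bump_next a b c k P) (k + 2) x"
  proof -
    have "poly (flat_bump_next a b c k P) x =
      poly (pderiv P) x * (q x)\<^sup>2 - real k * poly P x * (a + b - 2 * x) * q x + c * (poly P x * (a + b - 2 * x))"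
      by (simp add: flat_bump_next_def q_def Let_def algebra_simps)
    then show ?thesis using True by (simp add: flat_bump_def q_def)
  qed
  finally have *: "((\<lambda>x. poly P x / q x ^ k * exp (- c / q x)) has_real_derivative
      flat_bump a b c (flat_bump_next a b c k P) (k + 2) x) (at x)" .
  show ?thesis
    by (rule has_field_derivative_transform_within_open[OF *, of "{a<..<b}"])
       (use True in \<open>auto simp: flat_bump_def q_def\<close>)
qed

fun flat_bump_deriv_poly :: "real \<Rightarrow> real \<Rightarrow> real \<Rightarrow> real poly \<Rightarrow> nat \<Rightarrow> real poly" where
  "flat_bump_deriv_poly a b c P 0 = P"
| "flat_bump_deriv_poly a b c P (Suc i) = flat_bump_next a b c (2 * i) (flat_bump_deriv_poly a b c P i)"

lemma test_function_flat_bump: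
  assumes c: "c > 0" and ab: "0 < a" "b < 1"
  shows "test_function (flat_bump a b c P 0)"
proof -
  define D where "D i = flat_bump a b c (flat_bump_deriv_poly a b c P i) (2 * i)" for i
  have "(D i has_real_derivative D (Suc i) x) (at x within {0..1})" for i x
    using flat_bump_has_derivative[OF c, of a b "flat_bump_deriv_poly a b c P i" "2 * i" x]
    by (auto simp: D_def intro: DERIV_subset)
  moreover have "D 0 = flat_bump a b c P 0" by (simp add: D_def)
  moreover have "closure {x \<in> {0..1}. flat_bump a b c P 0 x \<noteq> 0} \<subseteq> {a..b}"
    by (rule closure_minimal) (auto simp: flat_bump_def)
  then have "closure {x \<in> {0..1}. flat_bump a b c P 0 x \<noteq> 0} \<subseteq> {0<..<1}"
    using ab by (auto simp: subset_eq)
  ultimately show ?thesis unfolding test_function_def by blast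
qed

lemma test_function_continuous_on:
  assumes "test_function f"
  shows "continuous_on {0..1} f"
  using assms unfolding test_function_def by (blast intro: DERIV_continuous_on)

lemma continuous_on_imp_borel_measurable_01:
  assumes "continuous_on {0..1} (f :: real \<Rightarrow> real)"
  shows "f \<in> borel_measurable (lebesgue_on {0<..<1})"
  by (intro continuous_imp_measurable_on_sets_lebesgue continuous_on_subset[OF assms]) auto

definition clamp_to :: "real \<Rightarrow> real \<Rightarrow> real" where
  "clamp_to M y = max (- M) (min M y)"

text \<open>First approximation step: replacing \<open>f\<close> by a bounded function provides the constant dominating
function that the second step requires.\<close>
lemma L2_truncation_limit:
  assumes f: "f \<in> L2"
  shows "(\<lambda>M::nat. \<integral>x. (clamp_to (real M) (f x) - f x)\<^sup>2 \<partial>lebesgue_on {0<..<1}) \<longlonglongrightarrow> 0"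
    and "integrable (lebesgue_on {0<..<1}) (\<lambda>x. (clamp_to (real M) (f x) - f x)\<^sup>2)"
proof -
  have meas[measurable]: "f \<in> borel_measurable (lebesgue_on {0<..<1})"
    and int: "integrable (lebesgue_on {0<..<1}) (\<lambda>x. (f x)\<^sup>2)"
    using f by (auto simp: L2_def)
  have dom: "(clamp_to (real M) y - y)\<^sup>2 \<le> y\<^sup>2" for M y
    by (rule power2_le_iff_abs_le[THEN iffD2, of "\<bar>y\<bar>", simplified])
       (auto simp: clamp_to_def)
  show "integrable (lebesgue_on {0<..<1}) (\<lambda>x. (clamp_to (real M) (f x) - f x)\<^sup>2)"
    by (rule Bochner_Integration.integrable_bound[OF int])
       (auto simp: clamp_to_def[abs_def] intro!: dom[unfolded clamp_to_def])
  have lim: "(\<lambda>M. (clamp_to (real M) y - y)\<^sup>2) \<longlonglongrightarrow> 0" for y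
  proof (rule tendsto_eventually)
    obtain N :: nat where N: "real N \<ge> \<bar>y\<bar>" using real_arch_simple by blast
    show "\<forall>\<^sub>F M in sequentially. (clamp_to (real M) y - y)\<^sup>2 = 0"
      using eventually_ge_at_top[of N]
    proof eventually_elim
      case (elim M)
      then have "real M \<ge> \<bar>y\<bar>" using N by linarith
      then show ?case by (auto simp: clamp_to_def min_def max_def)
    qed
  qed
  have "(\<lambda>M::nat. \<integral>x. (clamp_to (real M) (f x) - f x)\<^sup>2 \<partial>lebesgue_on {0<..<1})
      \<longlonglongrightarrow> (\<integral>x. 0 \<partial>lebesgue_on {0<..<1::real})"
  proof (rule integral_dominated_convergence[where w = "\<lambda>x. (f x)\<^sup>2"])
    show "(\<lambda>x. (clamp_to (real M) (f x) - f x)\<^sup>2) \<in> borel_measurable (lebesgue_on {0<..<1})" for M :: nat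
      unfolding clamp_to_def by measurable
  qed (use int lim dom in auto)
  then show "(\<lambda>M::nat. \<integral>x. (clamp_to (real M) (f x) - f x)\<^sup>2 \<partial>lebesgue_on {0<..<1}) \<longlonglongrightarrow> 0"
    by simp
qed

lemma continuous_approx_by_polynomial:
  assumes "continuous_on {0..1} (h :: real \<Rightarrow> real)" "e > 0"
  shows "\<exists>P. \<forall>x\<in>{0..1}. \<bar>h x - poly P x\<bar> < e"
proof -
  obtain g where g: "real_polynomial_function g" "\<And>x. x \<in> {0..1} \<Longrightarrow> \<bar>h x - g x\<bar> < e"
    using Stone_Weierstrass_real_polynomial_function[OF compact_Icc assms] by metis
  obtain a n where "g = (\<lambda>x. \<Sum>i\<le>n. a i * x ^ i)"
    using g(1) by (auto simp: real_polynomial_function_iff_sum)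
  then have "g x = poly (\<Sum>i\<le>n. Polynomial.monom (a i) i) x" for x
    by (simp add: poly_sum poly_monom)
  with g(2) show ?thesis by metis
qed

lemma flat_bump_tendsto:
  assumes x: "0 < x" "x < 1"
  shows "(\<lambda>n. flat_bump (1 / real (n + 3)) (1 - 1 / real (n + 3)) (1 / real (n + 3)) 1 0 x) \<longlonglongrightarrow> 1"
proof -
  define \<epsilon> where "\<epsilon> n = 1 / real (n + 3)" for n
  have \<epsilon>: "\<epsilon> \<longlonglongrightarrow> 0"
    unfolding \<epsilon>_def using LIMSEQ_ignore_initial_segment[OF lim_1_over_n, of 3] by simp
  have ev: "\<forall>\<^sub>F n in sequentially. exp (- \<epsilon> n / ((x - \<epsilon> n) * (1 - \<epsilon> n - x))) = flat_bump (\<epsilon> n) (1 - \<epsilon> n) (\<epsilon> n) 1 0 x"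
    using order_tendstoD(2)[OF \<epsilon> x(1)] order_tendstoD(2)[OF \<epsilon>, of "1 - x"] x
    by (rule_tac eventually_elim2[of "\<lambda>n. \<epsilon> n < x" _ "\<lambda>n. \<epsilon> n < 1 - x"]) (auto simp: flat_bump_def)
  have "(\<lambda>n. exp (- \<epsilon> n / ((x - \<epsilon> n) * (1 - \<epsilon> n - x)))) \<longlonglongrightarrow> exp (- 0 / ((x - 0) * (1 - 0 - x)))"
    using x by (intro tendsto_intros \<epsilon>) auto
  then have "(\<lambda>n. exp (- \<epsilon> n / ((x - \<epsilon> n) * (1 - \<epsilon> n - x)))) \<longlonglongrightarrow> 1" by simp
  from Lim_transform_eventually[OF this ev] show ?thesis by (simp add: \<epsilon>_def)
qed

lemma flat_bump_factor: "flat_bump a b c P 0 x = poly P x * flat_bump a b c 1 0 x"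
  by (simp add: flat_bump_def)

lemma flat_bump_1_range:
  assumes "c > 0" shows "0 \<le> flat_bump a b c 1 0 x" "flat_bump a b c 1 0 x \<le> 1"
  using assms by (auto simp: flat_bump_def divide_le_0_iff mult_nonneg_nonneg)

lemma AE_lebesgue_on_01_of_negligible:
  assumes N: "negligible N" and P: "\<And>x. 0 < x \<Longrightarrow> x < 1 \<Longrightarrow> x \<notin> N \<Longrightarrow> P x"
  shows "AE x in lebesgue_on {0<..<1::real}. P x"
proof -
  have "AE x in lebesgue. x \<notin> N"
    using N by (simp add: negligible_iff_null_sets AE_not_in)
  then show ?thesis
    by (subst AE_restrict_space_iff) (auto elim!: eventually_mono intro!: P)
qed

text \<open>A measurable function is a limit almost everywhere of continuous functions.  Clamping them to \<open>[- M, M]\<close>,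
replacing them by polynomials that are uniformly close, and multiplying by bumps that tend to 1 on
\<open>(0, 1)\<close> yields test functions with the same limit and a common bound, so that dominated
convergence applies.\<close>
lemma bounded_approx_by_test_functions:
  assumes f: "f \<in> borel_measurable (lebesgue_on {0<..<1})" and M: "M \<ge> 0"
    and bounded: "\<And>x. \<bar>f x\<bar> \<le> M"
  obtains T where "\<And>n :: nat. test_function (T n)"
    and "\<And>n. integrable (lebesgue_on {0<..<1}) (\<lambda>x. (T n x - f x)\<^sup>2)"
    and "(\<lambda>n. \<integral>x. (T n x - f x)\<^sup>2 \<partial>lebesgue_on {0<..<1}) \<longlonglongrightarrow> 0"
proof -
  note [measurable] = f
  have "f measurable_on {0<..<1}"
    using f by (subst measurable_on_iff_borel_measurable) auto
  then obtain N g where N: "negligible N" and g: "\<And>n :: nat. continuous_on UNIV (g n)"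
    and lim: "\<And>x. x \<notin> N \<Longrightarrow> (\<lambda>n. g n x) \<longlonglongrightarrow> (if x \<in> {0<..<1} then f x else 0)"
    unfolding measurable_on_def by metis
  have "\<exists>P. \<forall>x\<in>{0..1}. \<bar>clamp_to M (g n x) - poly P x\<bar> < 1 / real (n + 3)" for n
    unfolding clamp_to_def
    by (intro continuous_approx_by_polynomial continuous_intros continuous_on_subset[OF g]) auto
  then obtain P where P: "\<And>n x. x \<in> {0..1} \<Longrightarrow> \<bar>clamp_to M (g n x) - poly (P n) x\<bar> < 1 / real (n + 3)"
    by metis
  \<comment> \<open>The offset 3 makes the support of the bump a nonempty interval already for \<open>n = 0\<close>.\<close>
  define \<eta> where "\<eta> n = flat_bump (1 / real (n + 3)) (1 - 1 / real (n + 3)) (1 / real (n + 3)) 1 0" for n :: nat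
  define T where "T n = flat_bump (1 / real (n + 3)) (1 - 1 / real (n + 3)) (1 / real (n + 3)) (P n) 0" for n
  have T: "T n x = poly (P n) x * \<eta> n x" for n x
    unfolding T_def \<eta>_def by (rule flat_bump_factor)
  have test: "test_function (T n)" for n
    unfolding T_def by (rule test_function_flat_bump) auto
  have meas[measurable]: "T n \<in> borel_measurable (lebesgue_on {0<..<1})" for n
    by (intro continuous_on_imp_borel_measurable_01 test_function_continuous_on test)
  have bound: "\<bar>T n x - f x\<bar> \<le> 2 * M + 1" if "x \<in> {0<..<1}" for n x
  proof -
    have "\<bar>clamp_to M (g n x)\<bar> \<le> M" using M by (auto simp: clamp_to_def)
    moreover have "1 / real (n + 3) \<le> 1" by simp
    moreover have "\<bar>clamp_to M (g n x) - poly (P n) x\<bar> < 1 / real (n + 3)"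
      using that by (intro P) auto
    ultimately have "\<bar>poly (P n) x\<bar> \<le> M + 1" by linarith
    then have "\<bar>poly (P n) x\<bar> * \<bar>\<eta> n x\<bar> \<le> (M + 1) * 1"
      using flat_bump_1_range[of "1 / real (n + 3)"] unfolding \<eta>_def by (intro mult_mono) auto
    then have "\<bar>T n x\<bar> \<le> M + 1" by (simp add: T abs_mult)
    then show ?thesis using bounded[of x] by linarith
  qed
  have dom: "(T n x - f x)\<^sup>2 \<le> (2 * M + 1)\<^sup>2" if "x \<in> {0<..<1}" for n x
    using power_mono[OF bound[OF that, of n], of 2] by simp
  have const: "integrable (lebesgue_on {0<..<1}) (\<lambda>x::real. (2 * M + 1)\<^sup>2)"
    by (intro finite_measure.integrable_const finite_measure_lebesgue_on) auto
  have AE_dom: "AE x in lebesgue_on {0<..<1}. norm ((T n x - f x)\<^sup>2) \<le> (2 * M + 1)\<^sup>2" for n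
    by (rule AE_I2) (use dom in auto)
  have pointwise: "(\<lambda>n. (T n x - f x)\<^sup>2) \<longlonglongrightarrow> 0" if x: "0 < x" "x < 1" "x \<notin> N" for x
  proof -
    have "(\<lambda>n. clamp_to M (g n x)) \<longlonglongrightarrow> clamp_to M (f x)"
      unfolding clamp_to_def using lim[OF x(3)] x by (intro tendsto_intros) auto
    moreover have "clamp_to M (f x) = f x"
      using bounded[of x] by (auto simp: clamp_to_def)
    moreover have "(\<lambda>n. clamp_to M (g n x) - poly (P n) x) \<longlonglongrightarrow> 0"
    proof (rule Lim_null_comparison)
      show "\<forall>\<^sub>F n in sequentially. norm (clamp_to M (g n x) - poly (P n) x) \<le> 1 / real (n + 3)"
        using P x by (intro always_eventually) (auto intro: less_imp_le)
      show "(\<lambda>n. 1 / real (n + 3)) \<longlonglongrightarrow> 0"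
        using LIMSEQ_ignore_initial_segment[OF lim_1_over_n, of 3] by simp
    qed
    ultimately have "(\<lambda>n. clamp_to M (g n x) - (clamp_to M (g n x) - poly (P n) x)) \<longlonglongrightarrow> f x - 0"
      by (intro tendsto_diff) auto
    then have "(\<lambda>n. poly (P n) x) \<longlonglongrightarrow> f x" by simp
    moreover have "(\<lambda>n. \<eta> n x) \<longlonglongrightarrow> 1"
      unfolding \<eta>_def using x by (intro flat_bump_tendsto)
    ultimately have "(\<lambda>n. (poly (P n) x * \<eta> n x - f x)\<^sup>2) \<longlonglongrightarrow> (f x * 1 - f x)\<^sup>2"
      by (intro tendsto_intros)
    then show ?thesis by (simp add: T)
  qed
  have "(\<lambda>n. \<integral>x. (T n x - f x)\<^sup>2 \<partial>lebesgue_on {0<..<1}) \<longlonglongrightarrow> (\<integral>x. 0 \<partial>lebesgue_on {0<..<1::real})"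
  proof (rule integral_dominated_convergence[OF _ _ const _ AE_dom])
    show "AE x in lebesgue_on {0<..<1}. (\<lambda>n. (T n x - f x)\<^sup>2) \<longlonglongrightarrow> 0"
      by (rule AE_lebesgue_on_01_of_negligible[OF N pointwise])
  qed auto
  moreover have "integrable (lebesgue_on {0<..<1}) (\<lambda>x. (T n x - f x)\<^sup>2)" for n
    by (rule Bochner_Integration.integrable_bound[OF const]) (use AE_dom[of n] in auto)
  ultimately show thesis using that test by auto
qed

lemma test_functions_dense_L2:
  assumes f: "f \<in> L2" and e: "e > 0"
  shows "\<exists>g. test_function g \<and> L2_norm (\<lambda>x. g x - f x) < e"
proof -
  let ?\<Omega> = "lebesgue_on {0<..<1::real}"
  have [measurable]: "f \<in> borel_measurable ?\<Omega>" using f by (simp add: L2_def)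
  \<comment> \<open>Two errors below \<open>e\<^sup>2 / 4\<close> add up to less than \<open>e\<^sup>2\<close>, as \<open>(x + y)\<^sup>2 \<le> 2 x\<^sup>2 + 2 y\<^sup>2\<close>.\<close>
  have e2: "e\<^sup>2 / 4 > 0" using e by simp
  from order_tendstoD(2)[OF L2_truncation_limit(1)[OF f] e2]
  obtain M :: nat where M: "(\<integral>x. (clamp_to (real M) (f x) - f x)\<^sup>2 \<partial>?\<Omega>) < e\<^sup>2 / 4"
    by (auto simp: eventually_sequentially)
  define F where "F x = clamp_to (real M) (f x)" for x
  have F: "F \<in> borel_measurable ?\<Omega>" unfolding F_def clamp_to_def by measurable
  have "\<bar>F x\<bar> \<le> real M" for x by (auto simp: F_def clamp_to_def)
  then obtain T where T: "\<And>n :: nat. test_function (T n)"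
    and int: "\<And>n. integrable ?\<Omega> (\<lambda>x. (T n x - F x)\<^sup>2)"
    and lim: "(\<lambda>n. \<integral>x. (T n x - F x)\<^sup>2 \<partial>?\<Omega>) \<longlonglongrightarrow> 0"
    using bounded_approx_by_test_functions[OF F, of "real M"] by auto
  from order_tendstoD(2)[OF lim e2] obtain n where n: "(\<integral>x. (T n x - F x)\<^sup>2 \<partial>?\<Omega>) < e\<^sup>2 / 4"
    by (auto simp: eventually_sequentially)
  have int_F: "integrable ?\<Omega> (\<lambda>x. (F x - f x)\<^sup>2)"
    unfolding F_def by (rule L2_truncation_limit(2)[OF f])
  have "(T n x - f x)\<^sup>2 \<le> 2 * (T n x - F x)\<^sup>2 + 2 * (F x - f x)\<^sup>2" for x
    using zero_le_power2[of "T n x - F x - (F x - f x)"] by (simp add: power2_eq_square algebra_simps)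
  then have "(\<integral>x. (T n x - f x)\<^sup>2 \<partial>?\<Omega>) \<le> (\<integral>x. 2 * (T n x - F x)\<^sup>2 + 2 * (F x - f x)\<^sup>2 \<partial>?\<Omega>)"
    using int[of n] int_F by (intro integral_mono') auto
  also have "\<dots> = 2 * (\<integral>x. (T n x - F x)\<^sup>2 \<partial>?\<Omega>) + 2 * (\<integral>x. (F x - f x)\<^sup>2 \<partial>?\<Omega>)"
    using int[of n] int_F by simp
  also have "\<dots> < e\<^sup>2" using n M by (simp add: F_def)
  finally have "sqrt (\<integral>x. (T n x - f x)\<^sup>2 \<partial>?\<Omega>) < e"
    using e by (intro real_less_lsqrt) auto
  then show ?thesis using T by (auto simp: L2_norm_def)
qed

lemma L2_norm_vec_le_iff:
  assumes "n > 0" shows "L2_norm_vec n f \<le> e \<longleftrightarrow> (\<forall>j<n. L2_norm (f j) \<le> e)"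
proof -
  have "(\<lambda>j. L2_norm (f j)) ` {..<n} \<noteq> {}" using assms by (auto simp: lessThan_empty_iff)
  then show ?thesis unfolding L2_norm_vec_def by (subst Max_le_iff) auto
qed

lemma L2_norm_le_vec: "j < n \<Longrightarrow> L2_norm (f j) \<le> L2_norm_vec n f"
  unfolding L2_norm_vec_def by (rule Max_ge) auto

lemma L2_norm_nonneg: "L2_norm f \<ge> 0"
  by (simp add: L2_norm_def)

lemma L2_norm_vec_nonneg: "n > 0 \<Longrightarrow> L2_norm_vec n f \<ge> 0"
  using L2_norm_le_vec[of 0 n f] L2_norm_nonneg[of "f 0"] by linarith

lemma approx_initial_data:
  assumes n: "n > 0" and \<phi>: "\<And>j. j < n \<Longrightarrow> \<phi> j \<in> L2"
  obtains \<phi>l where "\<And>l j. j < n \<Longrightarrow> test_function (\<phi>l l j)"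
    and "(\<lambda>l. L2_norm_vec n (\<lambda>j x. \<phi>l l j x - \<phi> j x)) \<longlonglongrightarrow> 0"
proof -
  have "\<exists>g. \<forall>j<n. test_function (g j) \<and> L2_norm (\<lambda>x. g j x - \<phi> j x) < 1 / real (Suc l)" for l
    using test_functions_dense_L2[OF \<phi>, of _ "1 / real (Suc l)"]
    by (metis of_nat_0_less_iff zero_less_Suc zero_less_divide_1_iff)
  then obtain \<phi>l where \<phi>l: "\<And>l j. j < n \<Longrightarrow> test_function (\<phi>l l j)"
      "\<And>l j. j < n \<Longrightarrow> L2_norm (\<lambda>x. \<phi>l l j x - \<phi> j x) < 1 / real (Suc l)"
    by metis
  have "(\<lambda>l. L2_norm_vec n (\<lambda>j x. \<phi>l l j x - \<phi> j x)) \<longlonglongrightarrow> 0"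
  proof (rule tendsto_sandwich)
    show "\<forall>\<^sub>F l in sequentially. 0 \<le> L2_norm_vec n (\<lambda>j x. \<phi>l l j x - \<phi> j x)"
      using n by (simp add: L2_norm_vec_nonneg)
    show "\<forall>\<^sub>F l in sequentially. L2_norm_vec n (\<lambda>j x. \<phi>l l j x - \<phi> j x) \<le> 1 / real (Suc l)"
      using \<phi>l(2) by (simp add: L2_norm_vec_le_iff[OF n] less_imp_le)
    show "(\<lambda>l. 1 / real (Suc l)) \<longlonglongrightarrow> 0" by (rule LIMSEQ_Suc[OF lim_1_over_n])
  qed simp
  with \<phi>l(1) show thesis using that by blast
qed

section \<open>Travelling waves for unit speeds\<close>

text \<open>The regularity of test functions that matters for classical solutions.  Unlike smoothness with a chosen
sequence of derivatives, it is easily seen to pass to differences and reflections.\<close>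
definition C1_cutoff :: "(real \<Rightarrow> real) \<Rightarrow> (real \<Rightarrow> real) \<Rightarrow> bool" where
  "C1_cutoff \<psi> \<psi>' \<longleftrightarrow>
     (\<forall>x\<in>{0..1}. (\<psi> has_real_derivative \<psi>' x) (at x within {0..1})) \<and>
     continuous_on {0..1} \<psi>' \<and>
     (\<exists>\<delta>>0. \<forall>x\<in>{0..1}. x < \<delta> \<or> 1 - \<delta> < x \<longrightarrow> \<psi> x = 0)"

lemma C1_cutoff_continuous_on: "C1_cutoff \<psi> \<psi>' \<Longrightarrow> continuous_on {0..1} \<psi>"
  unfolding C1_cutoff_def by (blast intro: DERIV_continuous_on)

lemma C1_cutoff_diff:
  assumes "C1_cutoff \<psi> \<psi>'" "C1_cutoff \<eta> \<eta>'"
  shows "C1_cutoff (\<lambda>x. \<psi> x - \<eta> x) (\<lambda>x. \<psi>' x - \<eta>' x)"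
proof -
  obtain d e where "d > 0" "\<forall>x\<in>{0..1}. x < d \<or> 1 - d < x \<longrightarrow> \<psi> x = 0"
    and "e > 0" "\<forall>x\<in>{0..1}. x < e \<or> 1 - e < x \<longrightarrow> \<eta> x = 0"
    using assms unfolding C1_cutoff_def by metis
  then have "min d e > 0 \<and> (\<forall>x\<in>{0..1}. x < min d e \<or> 1 - min d e < x \<longrightarrow> \<psi> x - \<eta> x = 0)"
    by (auto simp: min_def split: if_splits)
  moreover have "continuous_on {0..1} (\<lambda>x. \<psi>' x - \<eta>' x)"
    using assms by (auto simp: C1_cutoff_def intro!: continuous_on_diff)
  moreover have "((\<lambda>x. \<psi> x - \<eta> x) has_real_derivative \<psi>' x - \<eta>' x) (at x within {0..1})" if "x \<in> {0..1}" for x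
    using assms that by (auto simp: C1_cutoff_def intro!: DERIV_diff)
  ultimately show ?thesis unfolding C1_cutoff_def by blast
qed

lemma C1_cutoff_reflect:
  assumes "C1_cutoff \<psi> \<psi>'"
  shows "C1_cutoff (\<lambda>x. \<psi> (1 - x)) (\<lambda>x. - \<psi>' (1 - x))"
proof -
  have "((\<lambda>x. \<psi> (1 - x)) has_real_derivative - \<psi>' (1 - x)) (at x within {0..1})" if "x \<in> {0..1}" for x
    using assms that by (intro has_real_derivative_reflect_01) (auto simp: C1_cutoff_def)
  moreover have "continuous_on {0..1} (\<lambda>x. - \<psi>' (1 - x))"
    using assms unfolding C1_cutoff_def
    by (intro continuous_on_minus continuous_on_compose2[of "{0..1}" \<psi>' "{0..1}" "\<lambda>x. 1 - x"] continuous_intros) auto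
  moreover obtain \<delta> where "\<delta> > 0" "\<forall>x\<in>{0..1}. x < \<delta> \<or> 1 - \<delta> < x \<longrightarrow> \<psi> x = 0"
    using assms unfolding C1_cutoff_def by metis
  then have "\<forall>x\<in>{0..1}. x < \<delta> \<or> 1 - \<delta> < x \<longrightarrow> \<psi> (1 - x) = 0" by auto
  ultimately show ?thesis using \<open>\<delta> > 0\<close> unfolding C1_cutoff_def by blast
qed

lemma test_function_C1_cutoff:
  assumes "test_function f"
  shows "\<exists>f'. C1_cutoff f f'"
proof -
  obtain D :: "nat \<Rightarrow> real \<Rightarrow> real" where D: "D 0 = f"
    "\<And>k x. x \<in> {0..1} \<Longrightarrow> (D k has_real_derivative D (Suc k) x) (at x within {0..1})"
    using assms unfolding test_function_def by metis
  define S where "S = closure {x\<in>{0..1}. f x \<noteq> 0}"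
  have S: "S \<subseteq> {0<..<1}" using assms by (simp add: test_function_def S_def)
  have "open (- S)" by (simp add: S_def open_Compl)
  moreover have "0 \<in> - S" "1 \<in> - S" using S by auto
  ultimately obtain d e where d: "d > 0" "ball 0 d \<subseteq> - S" and e: "e > 0" "ball 1 e \<subseteq> - S"
    unfolding open_contains_ball by metis
  have "f x = 0" if x: "x \<in> {0..1}" "x < min d e \<or> 1 - min d e < x" for x
  proof -
    have "x \<in> ball 0 d \<or> x \<in> ball 1 e" using x by (auto simp: dist_real_def)
    then have "x \<notin> S" using d e by auto
    then show ?thesis using x(1) closure_subset[of "{x\<in>{0..1}. f x \<noteq> 0}"] unfolding S_def by auto
  qed
  moreover have "continuous_on {0..1} (D 1)"
    using D(2)[of _ 1] by (blast intro: DERIV_continuous_on)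
  ultimately have "C1_cutoff f (D 1)"
    unfolding C1_cutoff_def using D(2)[of _ 0] D(1) d(1) e(1)
    by (auto intro!: exI[of _ "min d e"])
  then show ?thesis by blast
qed

lemma C1_cutoff_deriv_0:
  assumes \<psi>: "C1_cutoff \<psi> \<psi>'" and x: "x \<in> {0..1}" and \<delta>: "\<delta> > 0"
    and zero: "\<And>x. x \<in> {0..1} \<Longrightarrow> x < \<delta> \<or> 1 - \<delta> < x \<Longrightarrow> \<psi> x = 0"
    and near: "x < \<delta> \<or> 1 - \<delta> < x"
  shows "\<psi>' x = 0"
proof -
  define U where "U = {..<\<delta>} \<union> {1 - \<delta><..}"
  have "open U" "x \<in> U" using near by (auto simp: U_def)
  then obtain d where d: "d > 0" "ball x d \<subseteq> U" unfolding open_contains_ball by metis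
  have "(\<psi> has_real_derivative 0) (at x within {0..1})"
  proof (rule has_field_derivative_transform_within[OF _ d(1)])
    show "((\<lambda>_. 0) has_real_derivative 0) (at x within {0..1})" by simp
    fix y assume "y \<in> {0..1}" "dist y x < d"
    moreover from this have "y \<in> U" using d(2) by (auto simp: dist_commute)
    ultimately show "0 = \<psi> y" using zero by (auto simp: U_def)
  qed (use x in auto)
  moreover have "(\<psi> has_real_derivative \<psi>' x) (at x within {0..1})"
    using \<psi> x by (simp add: C1_cutoff_def)
  ultimately show ?thesis
    using x vector_derivative_unique_within_closed_interval[of 0 1 x \<psi> 0 "\<psi>' x"]
    by (simp add: has_real_derivative_iff_has_vector_derivative)
qed

text \<open>The pieces on the intervals between consecutive integers fit together in a \<open>C\<^sup>1\<close> way for arbitrary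
factors \<open>c\<close>, because \<open>\<psi>\<close> vanishes identically near both ends of \<open>[0, 1]\<close>.\<close>
lemma floor_pieces_C1:
  fixes c :: "int \<Rightarrow> real"
  assumes \<psi>: "C1_cutoff \<psi> \<psi>'"
  shows "((\<lambda>z. c \<lfloor>z\<rfloor> * \<psi> (frac z)) has_real_derivative c \<lfloor>z\<rfloor> * \<psi>' (frac z)) (at z)"
    and "isCont (\<lambda>z. c \<lfloor>z\<rfloor> * \<psi>' (frac z)) z"
proof -
  obtain \<delta>0 where \<delta>0: "\<delta>0 > 0" "\<And>x. x \<in> {0..1} \<Longrightarrow> x < \<delta>0 \<or> 1 - \<delta>0 < x \<Longrightarrow> \<psi> x = 0"
    using \<psi> unfolding C1_cutoff_def by metis
  \<comment> \<open>With \<open>\<delta> \<le> 1 / 2\<close> a neighbourhood of radius \<open>\<delta>\<close> of an integer contains no other integer.\<close>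
  define \<delta> where "\<delta> = min \<delta>0 (1 / 2)"
  have \<delta>: "\<delta> > 0" "\<delta> \<le> 1 / 2" using \<delta>0(1) by (auto simp: \<delta>_def)
  have zero: "\<psi> x = 0" "\<psi>' x = 0" if "x \<in> {0..1}" "x < \<delta> \<or> 1 - \<delta> < x" for x
  proof -
    have "x < \<delta>0 \<or> 1 - \<delta>0 < x" using that(2) unfolding \<delta>_def by linarith
    with C1_cutoff_deriv_0[OF \<psi> that(1) \<delta>0] \<delta>0(2)[OF that(1)]
    show "\<psi> x = 0" "\<psi>' x = 0" by blast+
  qed
  have "((\<lambda>z. c \<lfloor>z\<rfloor> * \<psi> (frac z)) has_real_derivative c \<lfloor>z\<rfloor> * \<psi>' (frac z)) (at z) \<and>
    isCont (\<lambda>z. c \<lfloor>z\<rfloor> * \<psi>' (frac z)) z"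
  proof (cases "z \<in> \<int>")
    case True
    then obtain N :: int where N: "z = of_int N" by (auto elim: Ints_cases)
    define U where "U = {z - \<delta><..<z + \<delta>}"
    have U: "open U" "z \<in> U" using \<delta> by (auto simp: U_def)
    have near: "frac y \<in> {0..1} \<and> (frac y < \<delta> \<or> 1 - \<delta> < frac y)" if y: "y \<in> U" for y
    proof (cases "y \<ge> z")
      case True
      then have "\<lfloor>y\<rfloor> = N" using y \<delta> by (auto simp: U_def N floor_eq_iff)
      then show ?thesis using True y \<delta> by (auto simp: U_def N frac_def)
    next
      case False
      then have "\<lfloor>y\<rfloor> = N - 1" using y \<delta> by (auto simp: U_def N floor_eq_iff)
      then show ?thesis using False y \<delta> by (auto simp: U_def N frac_def)
    qed
    have G: "c \<lfloor>y\<rfloor> * \<psi> (frac y) = 0" and G': "c \<lfloor>y\<rfloor> * \<psi>' (frac y) = 0" if "y \<in> U" for y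
      using near[OF that] zero by auto
    have "((\<lambda>_. 0) has_real_derivative c \<lfloor>z\<rfloor> * \<psi>' (frac z)) (at z)"
      unfolding G'[OF U(2)] by simp
    then have "((\<lambda>z. c \<lfloor>z\<rfloor> * \<psi> (frac z)) has_real_derivative c \<lfloor>z\<rfloor> * \<psi>' (frac z)) (at z)"
      by (rule has_field_derivative_transform_within_open[OF _ U]) (use G in auto)
    moreover have "continuous_on U (\<lambda>z. c \<lfloor>z\<rfloor> * \<psi>' (frac z))"
      by (simp add: G' cong: continuous_on_cong)
    ultimately show ?thesis using U by (auto simp: continuous_on_eq_continuous_at)
  next
    case False
    define N where "N = \<lfloor>z\<rfloor>"
    define U where "U = {of_int N<..<of_int N + 1 :: real}"
    have "frac z > 0" using False by (simp add: frac_gt_0_iff)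
    then have U: "open U" "z \<in> U" using floor_correct[of z] by (auto simp: U_def N_def frac_def)
    have fl: "\<lfloor>y\<rfloor> = N" if "y \<in> U" for y using that by (auto simp: U_def floor_eq_iff)
    have G: "c N * \<psi> (y - of_int N) = c \<lfloor>y\<rfloor> * \<psi> (frac y)"
      and G': "c \<lfloor>y\<rfloor> * \<psi>' (frac y) = c N * \<psi>' (y - of_int N)" if "y \<in> U" for y
      using fl[OF that] by (auto simp: frac_def)
    have "(\<psi> has_real_derivative \<psi>' (z - of_int N)) (at (z - of_int N) within {0..1})"
      using \<psi> U(2) by (auto simp: C1_cutoff_def U_def)
    moreover have "at (z - of_int N) within {0..1} = at (z - of_int N)"
      using U(2) by (intro at_within_Icc_at) (auto simp: U_def)
    ultimately have "(\<psi> has_real_derivative \<psi>' (z - of_int N)) (at (z - of_int N))" by simp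
    moreover have "((\<lambda>z. z - of_int N) has_real_derivative 1) (at z)"
      by (auto intro!: derivative_eq_intros)
    ultimately have "((\<lambda>z. \<psi> (z - of_int N)) has_real_derivative \<psi>' (z - of_int N) * 1) (at z)"
      by (rule DERIV_chain2)
    then have "((\<lambda>z. c N * \<psi> (z - of_int N)) has_real_derivative c \<lfloor>z\<rfloor> * \<psi>' (frac z)) (at z)"
      using DERIV_cmult[of "\<lambda>z. \<psi> (z - of_int N)" "\<psi>' (z - of_int N) * 1" z UNIV "c N"] G'[OF U(2)] by simp
    then have "((\<lambda>z. c \<lfloor>z\<rfloor> * \<psi> (frac z)) has_real_derivative c \<lfloor>z\<rfloor> * \<psi>' (frac z)) (at z)"
      by (rule has_field_derivative_transform_within_open[OF _ U]) (use G in auto)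
    moreover have "continuous_on {0..1} \<psi>'" using \<psi> by (simp add: C1_cutoff_def)
    then have "continuous_on U (\<lambda>z. \<psi>' (z - of_int N))"
      by (rule continuous_on_compose2) (auto simp: U_def intro!: continuous_intros)
    then have "continuous_on U (\<lambda>z. c N * \<psi>' (z - of_int N))"
      by (rule continuous_on_mult_left)
    then have "continuous_on U (\<lambda>z. c \<lfloor>z\<rfloor> * \<psi>' (frac z))"
      by (simp add: G' cong: continuous_on_cong)
    ultimately show ?thesis using U by (auto simp: continuous_on_eq_continuous_at)
  qed
  then show "((\<lambda>z. c \<lfloor>z\<rfloor> * \<psi> (frac z)) has_real_derivative c \<lfloor>z\<rfloor> * \<psi>' (frac z)) (at z)"
    and "isCont (\<lambda>z. c \<lfloor>z\<rfloor> * \<psi>' (frac z)) z" by auto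
qed

text \<open>If all components are transported from left to right with speed 1, component \<open>j\<close> at \<open>(y, t)\<close> is
\<open>wave n W \<psi> j (y - t)\<close>: a signal observed there has crossed the boundary \<open>- \<lfloor>y - t\<rfloor>\<close> times, and each
passage multiplies the vector of components by \<open>W\<close>.  For positive arguments the truncation by \<open>nat\<close>
selects the identity matrix.\<close>
definition wave :: "nat \<Rightarrow> real mat \<Rightarrow> (nat \<Rightarrow> real \<Rightarrow> real) \<Rightarrow> nat \<Rightarrow> real \<Rightarrow> real" where
  "wave n W \<psi> j z = (\<Sum>k<n. (W ^\<^sub>m nat (- \<lfloor>z\<rfloor>)) $$ (j, k) * \<psi> k (frac z))"

lemma wave_C1:
  assumes "\<And>k. k < n \<Longrightarrow> \<exists>\<psi>'. C1_cutoff (\<psi> k) \<psi>'"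
  shows "\<exists>w'. continuous_on UNIV w' \<and> (\<forall>z. (wave n W \<psi> j has_real_derivative w' z) (at z))"
proof -
  obtain \<psi>' where \<psi>': "\<And>k. k < n \<Longrightarrow> C1_cutoff (\<psi> k) (\<psi>' k)" using assms by metis
  define w' where "w' z = (\<Sum>k<n. (W ^\<^sub>m nat (- \<lfloor>z\<rfloor>)) $$ (j, k) * \<psi>' k (frac z))" for z
  have "(wave n W \<psi> j has_real_derivative w' z) (at z)" for z
    unfolding wave_def[abs_def] w'_def
    by (intro DERIV_sum floor_pieces_C1(1)[OF \<psi>', where c = "\<lambda>i. (W ^\<^sub>m nat (- i)) $$ (j, _)"]) auto
  moreover have "isCont w' z" for z
    unfolding w'_def
  proof (rule isCont_sum, rule ballI)
    fix k assume "k \<in> {..<n}"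
    then show "isCont (\<lambda>z. (W ^\<^sub>m nat (- \<lfloor>z\<rfloor>)) $$ (j, k) * \<psi>' k (frac z)) z"
      using floor_pieces_C1(2)[OF \<psi>'[of k], where c = "\<lambda>i. (W ^\<^sub>m nat (- i)) $$ (j, k)" and z = z] by simp
  qed
  ultimately show ?thesis by (auto simp: continuous_on_eq_continuous_at)
qed

lemma wave_continuous:
  assumes "\<And>k. k < n \<Longrightarrow> \<exists>\<psi>'. C1_cutoff (\<psi> k) \<psi>'"
  shows "continuous_on S (wave n W \<psi> j)"
proof -
  have "\<exists>w'. continuous_on UNIV w' \<and> (\<forall>z. (wave n W \<psi> j has_real_derivative w' z) (at z))"
    by (rule wave_C1[OF assms])
  then show ?thesis by (auto intro!: continuous_at_imp_continuous_on dest: DERIV_isCont)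
qed

lemma C1_cutoff_at_ends:
  assumes "C1_cutoff \<psi> \<psi>'" shows "\<psi> 0 = 0" "\<psi> 1 = 0"
  using assms unfolding C1_cutoff_def by fastforce+

text \<open>At \<open>x = 1\<close> the formula evaluates \<open>\<psi>\<close> at \<open>frac 1 = 0\<close> instead of \<open>1\<close>; both values are zero.\<close>
lemma wave_initial:
  assumes W: "W \<in> carrier_mat n n" and j: "j < n" and \<psi>: "\<And>k. k < n \<Longrightarrow> \<exists>\<psi>'. C1_cutoff (\<psi> k) \<psi>'"
    and x: "x \<in> {0..1}"
  shows "wave n W \<psi> j x = \<psi> j x"
proof -
  have "nat (- \<lfloor>x\<rfloor>) = 0" using x by simp
  then have "wave n W \<psi> j x = (\<Sum>k<n. if j = k then \<psi> k (frac x) else 0)"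
    unfolding wave_def using W j by (intro sum.cong) auto
  also have "\<dots> = \<psi> j (frac x)" using j by simp
  also have "\<dots> = \<psi> j x"
  proof (cases "x = 1")
    case True
    then show ?thesis using C1_cutoff_at_ends \<psi>[OF j] by (metis frac_1_eq frac_of_int of_int_0 of_int_1)
  next
    case False
    then show ?thesis using x by (simp add: frac_eq)
  qed
  finally show ?thesis .
qed

text \<open>The arguments \<open>- t\<close> and \<open>1 - t\<close> have the same fractional part, and the number of boundary
passages differs by one, except when the fractional part is zero; then both sides vanish.\<close>
lemma wave_boundary:
  assumes W: "W \<in> carrier_mat n n" and j: "j < n" and \<psi>: "\<And>k. k < n \<Longrightarrow> \<exists>\<psi>'. C1_cutoff (\<psi> k) \<psi>'"
    and t: "t \<ge> 0"
  shows "wave n W \<psi> j (- t) = (\<Sum>k<n. W $$ (j, k) * wave n W \<psi> k (1 - t))"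
proof -
  have fr: "frac (1 - t) = frac (- t)" using frac_1_eq[of "- t"] by (simp add: add.commute)
  show ?thesis
  proof (cases "frac (- t) = 0")
    case True
    have "\<psi> k 0 = 0" if "k < n" for k using \<psi>[OF that] C1_cutoff_at_ends by blast
    then have "wave n W \<psi> k z = 0" if "frac z = 0" for k z
      unfolding wave_def that by (auto intro!: sum.neutral)
    then show ?thesis using True fr by simp
  next
    case False
    define K where "K = nat (- \<lfloor>1 - t\<rfloor>)"
    have "t > 0" using t False by (cases "t = 0") auto
    then have "\<lfloor>- t\<rfloor> \<le> - 1" by linarith
    moreover have "\<lfloor>1 - t\<rfloor> = \<lfloor>- t\<rfloor> + 1" by linarith
    ultimately have K: "nat (- \<lfloor>- t\<rfloor>) = Suc K" by (simp add: K_def)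
    have "wave n W \<psi> j (- t) = (\<Sum>k<n. \<Sum>i<n. W $$ (j, i) * (W ^\<^sub>m K) $$ (i, k) * \<psi> k (frac (- t)))"
      unfolding wave_def K
      by (intro sum.cong refl, subst pow_mat_Suc_left_index[OF W j]) (auto simp: sum_distrib_right)
    also have "\<dots> = (\<Sum>i<n. \<Sum>k<n. W $$ (j, i) * (W ^\<^sub>m K) $$ (i, k) * \<psi> k (frac (- t)))"
      by (rule sum.swap)
    also have "\<dots> = (\<Sum>i<n. W $$ (j, i) * wave n W \<psi> i (1 - t))"
      by (simp add: wave_def fr K_def sum_distrib_left mult.assoc)
    finally show ?thesis .
  qed
qed

definition unit_speed :: "nat \<Rightarrow> nat \<Rightarrow> real \<Rightarrow> real \<Rightarrow> real" where
  "unit_speed m j x t = (if j < m then 1 else - 1)"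

text \<open>Initial data as functions of the distance from the inflow end, which is \<open>x = 1\<close> for the components
that travel to the left.\<close>
definition inflow_data :: "nat \<Rightarrow> (nat \<Rightarrow> real \<Rightarrow> real) \<Rightarrow> nat \<Rightarrow> real \<Rightarrow> real" where
  "inflow_data m \<phi> k x = (if k < m then \<phi> k x else \<phi> k (1 - x))"

definition wave_solution ::
  "nat \<Rightarrow> nat \<Rightarrow> real mat \<Rightarrow> (nat \<Rightarrow> real \<Rightarrow> real) \<Rightarrow> nat \<Rightarrow> real \<Rightarrow> real \<Rightarrow> real" where
  "wave_solution n m W \<phi> j x t =
     wave n W (inflow_data m \<phi>) j (if j < m then x - t else 1 - x - t)"

lemma C1_bounded_strip_const: "C1_bounded_strip (\<lambda>x t. c)"
  unfolding C1_bounded_strip_def C1_strip_def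
  by (intro exI[of _ "\<lambda>_ _. 0"] exI[of _ "\<bar>c\<bar>"]) (auto simp: case_prod_unfold intro!: continuous_intros)

lemma unit_speed_admissible: "m \<le> n \<Longrightarrow> admissible n m (unit_speed m) (\<lambda>_ _ _. 0)"
  unfolding admissible_def
  by (intro conjI exI[of _ 1]) (auto simp: unit_speed_def[abs_def] C1_bounded_strip_const)

lemma inflow_data_cutoff:
  assumes "\<exists>\<phi>'. C1_cutoff (\<phi> k) \<phi>'"
  shows "\<exists>\<psi>'. C1_cutoff (inflow_data m \<phi> k) \<psi>'"
  using assms C1_cutoff_reflect[of "\<phi> k"]
  by (cases "k < m") (auto simp: inflow_data_def[abs_def])

lemma C1_strip_travelling:
  fixes s :: real
  assumes w: "continuous_on UNIV w'" "\<And>z. (w has_real_derivative w' z) (at z)"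
  shows "C1_strip (\<lambda>x t. w (c + s * x - t)) (\<lambda>x t. w' (c + s * x - t) * s) (\<lambda>x t. - w' (c + s * x - t))"
proof -
  have wc: "continuous_on UNIV w"
    using w(2) by (meson DERIV_isCont continuous_at_imp_continuous_on)
  have "((\<lambda>y. c + s * y - t) has_real_derivative s) (at x within S)" for x t S
    by (auto intro!: derivative_eq_intros)
  from DERIV_chain2[OF w(2) this]
  have "((\<lambda>y. w (c + s * y - t)) has_real_derivative w' (c + s * x - t) * s) (at x within S)" for x t S .
  moreover have "((\<lambda>r. c + s * x - r) has_real_derivative - 1) (at t within S)" for x t S
    by (auto intro!: derivative_eq_intros)
  from DERIV_chain2[OF w(2) this]
  have "((\<lambda>r. w (c + s * x - r)) has_real_derivative - w' (c + s * x - t)) (at t within S)" for x t S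
    by simp
  ultimately show ?thesis
    unfolding C1_strip_def case_prod_unfold
    by (auto intro!: continuous_intros continuous_on_compose2[OF wc] continuous_on_compose2[OF w(1)])
qed

lemma wave_solution_classical:
  assumes W: "W \<in> carrier_mat n n" and m: "m \<le> n" and \<phi>: "\<And>k. k < n \<Longrightarrow> \<exists>\<phi>'. C1_cutoff (\<phi> k) \<phi>'"
  shows "classical_solution n m (unit_speed m) (\<lambda>_ _ _. 0) (\<lambda>j k t. W $$ (j, k)) \<phi>
           (wave_solution n m W \<phi>)"
proof -
  let ?\<psi> = "inflow_data m \<phi>" and ?u = "wave_solution n m W \<phi>"
  have \<psi>: "\<exists>\<psi>'. C1_cutoff (?\<psi> k) \<psi>'" if "k < n" for k
    using \<phi>[OF that] by (rule inflow_data_cutoff)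
  have pde: "\<exists>ux ut. C1_strip (?u j) ux ut \<and>
        (\<forall>x t. 0 < x \<and> x < 1 \<and> 0 < t \<longrightarrow> ut x t + unit_speed m j x t * ux x t + 0 * ?u j x t = 0)" for j
  proof -
    have "\<exists>w'. continuous_on UNIV w' \<and> (\<forall>z. (wave n W ?\<psi> j has_real_derivative w' z) (at z))"
      by (rule wave_C1[OF \<psi>])
    then obtain w' where w': "continuous_on UNIV w'" "\<And>z. (wave n W ?\<psi> j has_real_derivative w' z) (at z)"
      by auto
    show ?thesis
    proof (cases "j < m")
      case True
      then have "?u j = (\<lambda>x t. wave n W ?\<psi> j (0 + 1 * x - t))"
        by (simp add: wave_solution_def fun_eq_iff)
      then show ?thesis using C1_strip_travelling[OF w', of 0 1] True
        by (auto simp: unit_speed_def intro!: exI)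
    next
      case False
      then have "?u j = (\<lambda>x t. wave n W ?\<psi> j (1 + (- 1) * x - t))"
        by (simp add: wave_solution_def fun_eq_iff)
      then show ?thesis using C1_strip_travelling[OF w', of 1 "- 1"] False
        by (auto simp: unit_speed_def intro!: exI)
    qed
  qed
  have rhs: "boundary_rhs n m (\<lambda>j k t. W $$ (j, k)) ?u j t = wave n W ?\<psi> j (- t)"
    if j: "j < n" and t: "t \<ge> 0" for j t
  proof -
    have "boundary_rhs n m (\<lambda>j k t. W $$ (j, k)) ?u j t =
        (\<Sum>k<m. W $$ (j, k) * wave n W ?\<psi> k (1 - t)) + (\<Sum>k=m..<n. W $$ (j, k) * wave n W ?\<psi> k (1 - t))"
      by (simp add: boundary_rhs_def wave_solution_def)
    also have "\<dots> = (\<Sum>k<n. W $$ (j, k) * wave n W ?\<psi> k (1 - t))"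
      using m by (simp add: lessThan_atLeast0 sum.atLeastLessThan_concat)
    finally show ?thesis using wave_boundary[OF W j \<psi> t] by simp
  qed
  have init: "?u j x 0 = \<phi> j x" if "j < n" "x \<in> {0..1}" for j x
    using wave_initial[OF W that(1) \<psi>, where x = x] wave_initial[OF W that(1) \<psi>, where x = "1 - x"] that(2)
    by (auto simp: wave_solution_def inflow_data_def)
  show ?thesis
    unfolding classical_solution_def
    using pde rhs init m by (auto simp: wave_solution_def)
qed

section \<open>Square integral estimates and persistence of waves\<close>

lemma L2_of_continuous:
  assumes f: "continuous_on {0..1} f"
  shows "f \<in> L2" and "L2_norm f = sqrt (integral {0..1} (\<lambda>x. (f x)\<^sup>2))"
proof -
  let ?\<Omega> = "lebesgue_on {0<..<1::real}"
  note [measurable] = continuous_on_imp_borel_measurable_01[OF f]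
  have "compact (f ` {0..1})" by (intro compact_continuous_image f) auto
  then obtain B where B: "\<And>x. x \<in> {0..1} \<Longrightarrow> \<bar>f x\<bar> \<le> B"
    using compact_imp_bounded bounded_iff by (metis image_eqI real_norm_def)
  have const: "integrable ?\<Omega> (\<lambda>x::real. B\<^sup>2)"
    by (intro finite_measure.integrable_const finite_measure_lebesgue_on) auto
  have "(f x)\<^sup>2 \<le> B\<^sup>2" if "x \<in> {0<..<1}" for x
    using power_mono[of "\<bar>f x\<bar>" B 2] B[of x] that by simp
  then have "AE x in ?\<Omega>. norm ((f x)\<^sup>2) \<le> norm (B\<^sup>2)"
    by (intro AE_I2) auto
  then have int: "integrable ?\<Omega> (\<lambda>x. (f x)\<^sup>2)"
    by (intro Bochner_Integration.integrable_bound[OF const]) auto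
  then show "f \<in> L2" by (simp add: L2_def)
  have "(\<integral>x. (f x)\<^sup>2 \<partial>?\<Omega>) = integral {0<..<1} (\<lambda>x. (f x)\<^sup>2)"
    by (rule lebesgue_integral_eq_integral[OF int]) auto
  then show "L2_norm f = sqrt (integral {0..1} (\<lambda>x. (f x)\<^sup>2))"
    by (simp add: L2_norm_def integral_open_interval_real)
qed

lemma L2_norm_le_of_bound:
  assumes f: "continuous_on {0..1} f" and e: "e \<ge> 0" and le: "\<And>x. x \<in> {0..1} \<Longrightarrow> \<bar>f x\<bar> \<le> e"
  shows "L2_norm f \<le> e"
proof -
  have "(f x)\<^sup>2 \<le> e\<^sup>2" if "x \<in> {0..1}" for x
    using power_mono[of "\<bar>f x\<bar>" e 2] le[OF that] by simp
  then have "integral {0..1} (\<lambda>x. (f x)\<^sup>2) \<le> integral {0..1} (\<lambda>x::real. e\<^sup>2)"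
    by (intro integral_le integrable_continuous_real continuous_intros f) auto
  then have "integral {0..1} (\<lambda>x. (f x)\<^sup>2) \<le> e\<^sup>2" by simp
  then show ?thesis
    unfolding L2_of_continuous(2)[OF f] using e by (intro real_le_lsqrt) auto
qed

lemma integral_reflect_01:
  fixes f :: "real \<Rightarrow> real"
  shows "integral {0..1} (\<lambda>x. f (1 - x)) = integral {0..1} f"
proof -
  have "integral {0..1} f = integral {- 1..- 0} (\<lambda>x. f (- x))"
    by (rule Henstock_Kurzweil_Integration.integral_reflect_real[symmetric])
  also have "\<dots> = integral {- 1 - (- 1)..- 0 - (- 1)} (\<lambda>x. f (- (x + (- 1))))"
    by (rule integral_shift_real_ivl[symmetric])
  finally show ?thesis by simp
qed

text \<open>Shifting by whole periods reduces the claim to a shift by the fractional part of \<open>s\<close>, where the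
interval is cut at the point 1 and its right part is moved back by one period.\<close>
lemma integral_period:
  fixes h :: "real \<Rightarrow> real"
  assumes h: "continuous_on UNIV h" and per: "\<And>z. h (z + 1) = h z"
  shows "integral {0..1} (\<lambda>x. h (x + s)) = integral {0..1} h"
proof -
  have h_int: "h integrable_on {a..b}" for a b
    by (intro integrable_continuous_real continuous_on_subset[OF h]) auto
  have per_nat: "h (z + real k) = h z" for z k
  proof (induction k)
    case (Suc k)
    have "h (z + real (Suc k)) = h ((z + real k) + 1)" by (simp add: add_ac)
    then show ?case using per Suc by simp
  qed simp
  have per_int: "h (z + of_int i) = h z" for z i
  proof (cases "i \<ge> 0")
    case True
    then show ?thesis using per_nat[of z "nat i"] by simp
  next
    case False
    then show ?thesis using per_nat[of "z + of_int i" "nat (- i)"] by simp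
  qed
  define r where "r = frac s"
  have r: "0 \<le> r" "r \<le> 1" using frac_lt_1[of s] by (auto simp: r_def less_imp_le)
  have "h (x + s) = h (x + r)" for x
    using per_int[of "x + r" "\<lfloor>s\<rfloor>"] by (simp add: r_def frac_def)
  then have "integral {0..1} (\<lambda>x. h (x + s)) = integral {0..1} (\<lambda>x. h (x + r))" by simp
  also have "\<dots> = integral {r..1 + r} h"
    using integral_shift_real_ivl[of r r "1 + r" h] by simp
  also have "\<dots> = integral {r..1} h + integral {1..1 + r} h"
    using r by (intro Henstock_Kurzweil_Integration.integral_combine[symmetric] h_int) auto
  also have "integral {1..1 + r} h = integral {0..r} h"
    using integral_shift_real_ivl[of 1 1 "1 + r" h] by (simp add: per)
  also have "integral {r..1} h + integral {0..r} h = integral {0..1} h"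
    using Henstock_Kurzweil_Integration.integral_combine[OF r h_int] by simp
  finally show ?thesis .
qed

lemma integral_cutoff_square_shift:
  assumes \<psi>: "C1_cutoff \<psi> \<psi>'"
  shows "integral {0..1} (\<lambda>x. (\<psi> (frac (x + s)))\<^sup>2) = integral {0..1} (\<lambda>x. (\<psi> x)\<^sup>2)"
    and "continuous_on S (\<lambda>z. \<psi> (frac z))"
proof -
  have cont: "continuous_on S (\<lambda>z. \<psi> (frac z))" for S
    using floor_pieces_C1(1)[OF \<psi>, where c = "\<lambda>_. 1"]
    by (auto intro!: continuous_at_imp_continuous_on dest: DERIV_isCont)
  then show "continuous_on S (\<lambda>z. \<psi> (frac z))" .
  have "integral {0..1} (\<lambda>x. (\<psi> (frac (x + s)))\<^sup>2) = integral {0..1} (\<lambda>x. (\<psi> (frac x))\<^sup>2)"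
    by (rule integral_period[where h = "\<lambda>z. (\<psi> (frac z))\<^sup>2"])
       (auto intro!: continuous_intros cont simp: frac_1_eq)
  also have "\<dots> = integral {0..1} (\<lambda>x. (\<psi> x)\<^sup>2)"
  proof (rule integral_cong)
    fix x :: real assume x: "x \<in> {0..1}"
    show "(\<psi> (frac x))\<^sup>2 = (\<psi> x)\<^sup>2"
    proof (cases "x = 1")
      case True
      then show ?thesis using C1_cutoff_at_ends[OF \<psi>] frac_of_int[of 1] by simp
    next
      case False
      then show ?thesis using x by (simp add: frac_eq)
    qed
  qed
  finally show "integral {0..1} (\<lambda>x. (\<psi> (frac (x + s)))\<^sup>2) = integral {0..1} (\<lambda>x. (\<psi> x)\<^sup>2)" .
qed

text \<open>Up to time \<open>N\<close> at most \<open>N\<close> boundary passages occur, so the matrix entries involved are bounded by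
\<open>B\<close>, and translations of the periodically continued data preserve the square integral.\<close>
lemma wave_square_integral_le:
  fixes W :: "real mat"
  assumes W: "W \<in> carrier_mat n n" and j: "j < n" and \<psi>: "\<And>k. k < n \<Longrightarrow> \<exists>\<psi>'. C1_cutoff (\<psi> k) \<psi>'"
    and B: "\<And>s k. s \<le> N \<Longrightarrow> k < n \<Longrightarrow> \<bar>(W ^\<^sub>m s) $$ (j, k)\<bar> \<le> B"
    and t: "t \<le> real N"
    and V: "\<And>k. k < n \<Longrightarrow> integral {0..1} (\<lambda>x. (\<psi> k x)\<^sup>2) \<le> V\<^sup>2"
  shows "integral {0..1} (\<lambda>x. (wave n W \<psi> j (x - t))\<^sup>2) \<le> (B * real n * V)\<^sup>2"
proof -
  obtain \<psi>' where \<psi>': "\<And>k. k < n \<Longrightarrow> C1_cutoff (\<psi> k) (\<psi>' k)" using \<psi> by metis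
  note \<psi>_cont = integral_cutoff_square_shift(2)[OF \<psi>']
  have w_cont: "continuous_on {0..1} (\<lambda>x. wave n W \<psi> j (x - t))"
    by (rule continuous_on_compose2[OF wave_continuous[OF \<psi>, where S = UNIV]]) (auto intro!: continuous_intros)
  have k_cont: "continuous_on {0..1} (\<lambda>x. \<psi> k (frac (x - t)))" if "k < n" for k
    by (rule continuous_on_compose2[OF \<psi>_cont[OF that, where S = UNIV]]) (auto intro!: continuous_intros)
  have pointwise: "(wave n W \<psi> j (x - t))\<^sup>2 \<le> B\<^sup>2 * real n * (\<Sum>k<n. (\<psi> k (frac (x - t)))\<^sup>2)"
    if x: "x \<in> {0..1}" for x
  proof -
    define K where "K = nat (- \<lfloor>x - t\<rfloor>)"
    have "- \<lfloor>x - t\<rfloor> \<le> int N" using x t by (simp add: le_floor_iff minus_le_iff)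
    then have K: "K \<le> N" by (simp add: K_def)
    have sq: "((W ^\<^sub>m K) $$ (j, k))\<^sup>2 \<le> B\<^sup>2" if "k < n" for k
      using power_mono[of "\<bar>(W ^\<^sub>m K) $$ (j, k)\<bar>" B 2] B[OF K that] by simp
    have "(wave n W \<psi> j (x - t))\<^sup>2 \<le> (\<Sum>k<n. ((W ^\<^sub>m K) $$ (j, k) * \<psi> k (frac (x - t)))\<^sup>2) * real n"
      using sum_squared_le_sum_of_squares[of "\<lambda>k. (W ^\<^sub>m K) $$ (j, k) * \<psi> k (frac (x - t))" "{..<n}"]
      by (simp add: wave_def K_def)
    also have "\<dots> \<le> (\<Sum>k<n. B\<^sup>2 * (\<psi> k (frac (x - t)))\<^sup>2) * real n"
      using sq by (intro mult_right_mono sum_mono) (auto simp: power_mult_distrib intro!: mult_right_mono)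
    finally show ?thesis by (simp add: sum_distrib_left mult_ac)
  qed
  have int_k: "(\<lambda>x. (\<psi> k (frac (x - t)))\<^sup>2) integrable_on {0..1}" if "k < n" for k
    by (intro integrable_continuous_real continuous_intros k_cont that)
  have "integral {0..1} (\<lambda>x. (wave n W \<psi> j (x - t))\<^sup>2)
      \<le> integral {0..1} (\<lambda>x. B\<^sup>2 * real n * (\<Sum>k<n. (\<psi> k (frac (x - t)))\<^sup>2))"
    by (intro integral_le integrable_continuous_real continuous_intros w_cont k_cont pointwise) auto
  also have "\<dots> = B\<^sup>2 * real n * (\<Sum>k<n. integral {0..1} (\<lambda>x. (\<psi> k (frac (x - t)))\<^sup>2))"
  proof -
    have "integral {0..1} (\<lambda>x. \<Sum>k<n. (\<psi> k (frac (x - t)))\<^sup>2) = (\<Sum>k<n. integral {0..1} (\<lambda>x. (\<psi> k (frac (x - t)))\<^sup>2))"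
      by (rule Henstock_Kurzweil_Integration.integral_sum) (use int_k in auto)
    then show ?thesis by simp
  qed
  also have "\<dots> = B\<^sup>2 * real n * (\<Sum>k<n. integral {0..1} (\<lambda>x. (\<psi> k x)\<^sup>2))"
    using integral_cutoff_square_shift(1)[OF \<psi>', of _ "- t"] by simp
  also have "\<dots> \<le> B\<^sup>2 * real n * (\<Sum>k<n. V\<^sup>2)"
    using V by (intro mult_left_mono sum_mono) auto
  also have "\<dots> = (B * real n * V)\<^sup>2" by (simp add: power2_eq_square mult_ac)
  finally show ?thesis .
qed

lemma wave_diff: "wave n W \<psi> j z - wave n W \<eta> j z = wave n W (\<lambda>k x. \<psi> k x - \<eta> k x) j z"
  by (simp add: wave_def sum_subtractf right_diff_distrib)

lemma wave_solution_continuous: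
  assumes \<phi>: "\<And>k. k < n \<Longrightarrow> \<exists>\<phi>'. C1_cutoff (\<phi> k) \<phi>'"
  shows "continuous_on {0..1} (\<lambda>x. wave_solution n m W \<phi> j x t)"
proof -
  have "continuous_on UNIV (wave n W (inflow_data m \<phi>) j)"
    by (intro wave_continuous inflow_data_cutoff \<phi>)
  then show ?thesis
    unfolding wave_solution_def
    by (rule continuous_on_compose2) (cases "j < m"; auto intro!: continuous_intros)+
qed

text \<open>The solution depends linearly on the data, so the previous estimate bounds the difference of two
solutions, uniformly for times in a bounded interval.\<close>
lemma wave_solution_diff_L2:
  fixes W :: "real mat"
  assumes W: "W \<in> carrier_mat n n" and j: "j < n"
    and \<phi>: "\<And>k. k < n \<Longrightarrow> \<exists>\<phi>'. C1_cutoff (\<phi> k) \<phi>'" and \<eta>: "\<And>k. k < n \<Longrightarrow> \<exists>\<eta>'. C1_cutoff (\<eta> k) \<eta>'"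
    and B: "\<And>s k. s \<le> N \<Longrightarrow> k < n \<Longrightarrow> \<bar>(W ^\<^sub>m s) $$ (j, k)\<bar> \<le> B" and B0: "B \<ge> 0"
    and t: "t \<le> real N"
    and V: "\<And>k. k < n \<Longrightarrow> L2_norm (\<lambda>x. \<phi> k x - \<eta> k x) \<le> V"
  shows "L2_norm (\<lambda>x. wave_solution n m W \<phi> j x t - wave_solution n m W \<eta> j x t) \<le> B * real n * V"
proof -
  define \<psi> where "\<psi> k x = inflow_data m \<phi> k x - inflow_data m \<eta> k x" for k x
  define g where "g x = wave n W \<psi> j (x - t)" for x
  have \<psi>: "\<exists>\<psi>'. C1_cutoff (\<psi> k) \<psi>'" if "k < n" for k
    unfolding \<psi>_def
    using inflow_data_cutoff[of \<phi> k m, OF \<phi>[OF that]] inflow_data_cutoff[of \<eta> k m, OF \<eta>[OF that]]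
    by (blast intro: C1_cutoff_diff)
  have diff_cont: "continuous_on {0..1} (\<lambda>x. \<phi> k x - \<eta> k x)" if "k < n" for k
    using \<phi>[OF that] \<eta>[OF that] C1_cutoff_continuous_on by (blast intro: continuous_on_diff)
  have V0: "V \<ge> 0" using V[OF j] L2_norm_nonneg[of "\<lambda>x. \<phi> j x - \<eta> j x"] by linarith
  have "integral {0..1} (\<lambda>x. (\<psi> k x)\<^sup>2) \<le> V\<^sup>2" if k: "k < n" for k
  proof -
    have "integral {0..1} (\<lambda>x. (\<psi> k x)\<^sup>2) = integral {0..1} (\<lambda>x. (\<phi> k x - \<eta> k x)\<^sup>2)"
      using integral_reflect_01[of "\<lambda>x. (\<phi> k x - \<eta> k x)\<^sup>2"]
      by (cases "k < m") (auto simp: \<psi>_def inflow_data_def)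
    moreover have "sqrt (integral {0..1} (\<lambda>x. (\<phi> k x - \<eta> k x)\<^sup>2)) \<le> V"
      using V[OF k] unfolding L2_of_continuous(2)[OF diff_cont[OF k]] .
    ultimately show ?thesis by (simp add: sqrt_le_D)
  qed
  then have g_le: "integral {0..1} (\<lambda>x. (g x)\<^sup>2) \<le> (B * real n * V)\<^sup>2"
    unfolding g_def by (intro wave_square_integral_le[OF W j \<psi> B t])
  have eq: "wave_solution n m W \<phi> j x t - wave_solution n m W \<eta> j x t = g (if j < m then x else 1 - x)" for x
    by (auto simp: wave_solution_def wave_diff g_def \<psi>_def[abs_def])
  have "integral {0..1} (\<lambda>x. (g (if j < m then x else 1 - x))\<^sup>2) = integral {0..1} (\<lambda>x. (g x)\<^sup>2)"
    using integral_reflect_01[of "\<lambda>x. (g x)\<^sup>2"] by (cases "j < m") auto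
  moreover have "continuous_on {0..1} (\<lambda>x. g (if j < m then x else 1 - x))"
    unfolding eq[symmetric]
    by (intro continuous_on_diff wave_solution_continuous \<phi> \<eta>)
  ultimately have "L2_norm (\<lambda>x. g (if j < m then x else 1 - x)) \<le> B * real n * V"
    using g_le B0 V0 by (subst L2_of_continuous(2)) (auto intro!: real_le_lsqrt)
  then show ?thesis by (simp add: eq)
qed

lemma wave_solution_C_L2:
  assumes \<phi>: "\<And>k. k < n \<Longrightarrow> \<exists>\<phi>'. C1_cutoff (\<phi> k) \<phi>'"
  shows "C_L2 (wave_solution n m W \<phi> j)"
proof -
  let ?u = "wave_solution n m W \<phi> j" and ?w = "wave n W (inflow_data m \<phi>) j"
  have w: "continuous_on S ?w" for S by (intro wave_continuous inflow_data_cutoff \<phi>)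
  have u: "continuous_on {0..1} (\<lambda>x. ?u x t)" for t by (rule wave_solution_continuous[OF \<phi>])
  have "((\<lambda>s. L2_norm (\<lambda>x. ?u x s - ?u x t)) \<longlongrightarrow> 0) (at t within {0..})" for t
  proof (rule tendstoI)
    fix e :: real assume e: "e > 0"
    have "uniformly_continuous_on {- t - 1..2 - t} ?w"
      by (intro compact_uniformly_continuous w) auto
    then obtain d where d: "d > 0" "\<And>y z. y \<in> {- t - 1..2 - t} \<Longrightarrow> z \<in> {- t - 1..2 - t} \<Longrightarrow>
        dist z y < d \<Longrightarrow> dist (?w z) (?w y) < e / 2"
      unfolding uniformly_continuous_on_def using e by (metis half_gt_zero)
    have "dist (L2_norm (\<lambda>x. ?u x s - ?u x t)) 0 < e" if s: "dist s t < min d 1" for s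
    proof -
      have "\<bar>?u x s - ?u x t\<bar> \<le> e / 2" if x: "x \<in> {0..1}" for x
      proof -
        define y where "y = (if j < m then x else 1 - x)"
        have "y \<in> {0..1}" using x by (simp add: y_def)
        then have "dist (?w (y - s)) (?w (y - t)) < e / 2"
          using s by (intro d(2)) (auto simp: dist_real_def)
        then show ?thesis
          by (auto simp: wave_solution_def y_def dist_real_def split: if_splits)
      qed
      then have "L2_norm (\<lambda>x. ?u x s - ?u x t) \<le> e / 2"
        using e by (intro L2_norm_le_of_bound continuous_on_diff u) auto
      then show ?thesis using e L2_norm_nonneg[of "\<lambda>x. ?u x s - ?u x t"] by simp
    qed
    then show "\<forall>\<^sub>F s in at t within {0..}. dist (L2_norm (\<lambda>x. ?u x s - ?u x t)) 0 < e"
      unfolding eventually_at using d(1) by (intro exI[of _ "min d 1"]) auto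
  qed
  then show ?thesis
    unfolding C_L2_def using L2_of_continuous(1)[OF u] by auto
qed

text \<open>For arbitrary approximating data the classical solutions are waves as well, and the \<open>L\<^sup>2\<close> estimate
turns convergence of the data into convergence that is uniform on \<open>[0, T]\<close>.\<close>
lemma wave_solution_generalized:
  fixes W :: "real mat"
  assumes n: "n > 0" and W: "W \<in> carrier_mat n n" and m: "m \<le> n"
    and \<phi>: "\<And>k. k < n \<Longrightarrow> \<exists>\<phi>'. C1_cutoff (\<phi> k) \<phi>'"
  shows "L2_generalized_solution n m (unit_speed m) (\<lambda>_ _ _. 0) (\<lambda>j k t. W $$ (j, k)) \<phi>
           (wave_solution n m W \<phi>)"
  unfolding L2_generalized_solution_def
proof (intro conjI allI impI)
  fix j assume "j < n"
  show "C_L2 (wave_solution n m W \<phi> j)" by (rule wave_solution_C_L2[OF \<phi>])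
next
  fix \<phi>l :: "nat \<Rightarrow> nat \<Rightarrow> real \<Rightarrow> real"
  assume test: "\<forall>l. \<forall>j<n. test_function (\<phi>l l j)"
    and lim: "(\<lambda>l. L2_norm_vec n (\<lambda>j x. \<phi>l l j x - \<phi> j x)) \<longlonglongrightarrow> 0"
  have \<phi>l: "\<exists>\<eta>'. C1_cutoff (\<phi>l l k) \<eta>'" if "k < n" for l k
    using test that test_function_C1_cutoff by blast
  define V where "V l = L2_norm_vec n (\<lambda>j x. \<phi>l l j x - \<phi> j x)" for l
  have uniform: "uniform_limit {0..T}
      (\<lambda>l t. L2_norm_vec n (\<lambda>j x. wave_solution n m W \<phi> j x t - wave_solution n m W (\<phi>l l) j x t))
      (\<lambda>t. 0) sequentially" for T
  proof -
    define N where "N = nat \<lceil>T\<rceil>"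
    \<comment> \<open>The sum of all absolute values is a convenient bound for each of the finitely many entries.\<close>
    define B where "B = (\<Sum>s\<le>N. \<Sum>j<n. \<Sum>k<n. \<bar>(W ^\<^sub>m s) $$ (j, k)\<bar>)"
    have B0: "B \<ge> 0" unfolding B_def by (intro sum_nonneg) auto
    have B: "\<bar>(W ^\<^sub>m s) $$ (j, k)\<bar> \<le> B" if "s \<le> N" "j < n" "k < n" for s j k
    proof -
      have "\<bar>(W ^\<^sub>m s) $$ (j, k)\<bar> \<le> (\<Sum>k<n. \<bar>(W ^\<^sub>m s) $$ (j, k)\<bar>)"
        using that by (intro member_le_sum[where f = "\<lambda>k. \<bar>(W ^\<^sub>m s) $$ (j, k)\<bar>"]) auto
      also have "\<dots> \<le> (\<Sum>j<n. \<Sum>k<n. \<bar>(W ^\<^sub>m s) $$ (j, k)\<bar>)"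
        using that by (intro member_le_sum[where f = "\<lambda>j. \<Sum>k<n. \<bar>(W ^\<^sub>m s) $$ (j, k)\<bar>"] sum_nonneg) auto
      also have "\<dots> \<le> B"
        unfolding B_def using that
        by (intro member_le_sum[where f = "\<lambda>s. \<Sum>j<n. \<Sum>k<n. \<bar>(W ^\<^sub>m s) $$ (j, k)\<bar>"] sum_nonneg) auto
      finally show ?thesis .
    qed
    have le: "L2_norm_vec n (\<lambda>j x. wave_solution n m W \<phi> j x t - wave_solution n m W (\<phi>l l) j x t)
        \<le> B * real n * V l" if t: "t \<in> {0..T}" for t l
    proof -
      have "T \<le> real N" unfolding N_def by (rule real_nat_ceiling_ge)
      then have tN: "t \<le> real N" using t by simp
      have V: "L2_norm (\<lambda>x. \<phi> k x - \<phi>l l k x) \<le> V l" if "k < n" for k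
        using L2_norm_le_vec[OF that, of "\<lambda>j x. \<phi>l l j x - \<phi> j x"]
        by (simp add: V_def L2_norm_def power2_commute)
      show ?thesis
        unfolding L2_norm_vec_le_iff[OF n]
        by (intro allI impI wave_solution_diff_L2[OF W _ \<phi> \<phi>l B B0 tN V])
    qed
    show ?thesis
    proof (rule uniform_limitI)
      fix e :: real assume e: "e > 0"
      have "(\<lambda>l. B * real n * V l) \<longlonglongrightarrow> B * real n * 0"
        unfolding V_def by (intro tendsto_intros lim)
      then have "\<forall>\<^sub>F l in sequentially. B * real n * V l < e"
        using e by (intro order_tendstoD(2)[where y = 0]) auto
      then show "\<forall>\<^sub>F l in sequentially. \<forall>t\<in>{0..T}. dist (L2_norm_vec n
          (\<lambda>j x. wave_solution n m W \<phi> j x t - wave_solution n m W (\<phi>l l) j x t)) 0 < e"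
      proof eventually_elim
        case (elim l)
        then show ?case
          using le[of _ l] L2_norm_vec_nonneg[OF n] by (force simp: dist_real_def)
      qed
    qed
  qed
  have "classical_solution n m (unit_speed m) (\<lambda>_ _ _. 0) (\<lambda>j k t. W $$ (j, k)) (\<phi>l l)
      (wave_solution n m W (\<phi>l l))" for l
    by (rule wave_solution_classical[OF W m \<phi>l])
  then show "\<exists>ul. (\<forall>l. classical_solution n m (unit_speed m) (\<lambda>_ _ _. 0) (\<lambda>j k t. W $$ (j, k)) (\<phi>l l) (ul l)) \<and>
      (\<forall>T>0. uniform_limit {0..T} (\<lambda>l t. L2_norm_vec n (\<lambda>j x. wave_solution n m W \<phi> j x t - ul l j x t))
        (\<lambda>t. 0) sequentially)"
    using uniform by (intro exI[of _ "\<lambda>l. wave_solution n m W (\<phi>l l)"]) auto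
qed

text \<open>With the same positive bump as initial datum in every component, nothing can cancel.  At an integer
time \<open>N\<close> the solution is \<open>W ^\<^sub>m N\<close> applied to the initial data, and a component at which a walk of length
\<open>N\<close> starts is still positive on \<open>(1/4, 3/4)\<close>.\<close>
lemma sinkless_not_FTS:
  fixes W :: "real mat"
  assumes W: "W \<in> carrier_mat n n" and nn: "\<And>i j. i < n \<Longrightarrow> j < n \<Longrightarrow> W $$ (i, j) \<ge> 0" and m: "m \<le> n"
    and sink: "sinkless n W I"
  shows "\<not> FTS n m (unit_speed m) (\<lambda>_ _ _. 0) (\<lambda>j k t. W $$ (j, k))"
proof
  assume "FTS n m (unit_speed m) (\<lambda>_ _ _. 0) (\<lambda>j k t. W $$ (j, k))"
  then obtain Te where Te: "\<And>\<phi> u t j. (\<forall>j<n. \<phi> j \<in> L2) \<Longrightarrow>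
      L2_generalized_solution n m (unit_speed m) (\<lambda>_ _ _. 0) (\<lambda>j k t. W $$ (j, k)) \<phi> u \<Longrightarrow>
      t > Te \<Longrightarrow> j < n \<Longrightarrow> AE x in lebesgue_on {0<..<1}. u j x t = 0"
    unfolding FTS_def by blast
  have n: "n > 0" using sink unfolding sinkless_def by auto
  define \<beta> where "\<beta> = flat_bump (1 / 4) (3 / 4) 1 1 0"
  define \<phi> where "\<phi> = (\<lambda>k :: nat. \<beta>)"
  have test: "test_function \<beta>" unfolding \<beta>_def by (rule test_function_flat_bump) auto
  have \<phi>: "\<exists>\<phi>'. C1_cutoff (\<phi> k) \<phi>'" for k
    unfolding \<phi>_def by (rule test_function_C1_cutoff[OF test])
  have \<phi>_L2: "\<phi> k \<in> L2" for k
    unfolding \<phi>_def by (rule L2_of_continuous(1)[OF test_function_continuous_on[OF test]])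
  have pos: "\<beta> x > 0" if "x \<in> {1/4<..<3/4}" for x
    using that by (simp add: \<beta>_def flat_bump_def)
  obtain N :: nat where N: "real N > Te" using reals_Archimedean2 by blast
  obtain f where f: "walk n W N f" using sinkless_imp_walk[OF sink] by blast
  define j where "j = f 0"
  have j: "j < n" and fN: "f N < n" using f by (auto simp: walk_def j_def)
  have "AE x in lebesgue_on {0<..<1}. wave_solution n m W \<phi> j x (real N) = 0"
    by (rule Te[OF _ wave_solution_generalized[OF n W m \<phi>] N j]) (use \<phi>_L2 in auto)
  moreover have "wave_solution n m W \<phi> j x (real N) > 0" if x: "x \<in> {1/4<..<3/4}" for x
  proof -
    define y where "y = (if j < m then x else 1 - x)"
    have y: "y \<in> {1/4<..<3/4}" using x by (auto simp: y_def)
    have fl: "\<lfloor>y - real N\<rfloor> = - int N" using y by (simp add: floor_eq_iff)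
    have fr: "frac (y - real N) = y" using fl by (simp add: frac_def)
    have psi: "inflow_data m \<phi> k y > 0" for k
      using y pos[of y] pos[of "1 - y"] by (auto simp: inflow_data_def \<phi>_def)
    have "0 < (W ^\<^sub>m N) $$ (j, f N) * inflow_data m \<phi> (f N) y"
      using walk_imp_pow_mat_pos[OF W nn f] psi by (simp add: j_def)
    also have "\<dots> \<le> (\<Sum>k<n. (W ^\<^sub>m N) $$ (j, k) * inflow_data m \<phi> k y)"
      using fN j psi pow_mat_nonneg[OF W nn]
      by (intro member_le_sum[where f = "\<lambda>k. (W ^\<^sub>m N) $$ (j, k) * inflow_data m \<phi> k y"])
         (auto intro!: mult_nonneg_nonneg intro: less_imp_le)
    also have "\<dots> = wave n W (inflow_data m \<phi>) j (y - real N)"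
      by (simp add: wave_def fl fr)
    also have "\<dots> = wave_solution n m W \<phi> j x (real N)"
      by (simp add: wave_solution_def y_def)
    finally show ?thesis .
  qed
  then have "x \<notin> {1/4<..<3/4}" if "wave_solution n m W \<phi> j x (real N) = 0" for x
    using that by fastforce
  ultimately have "AE x in lebesgue_on {0<..<1}. x \<notin> {1/4<..<3/4::real}"
    by (rule eventually_mono)
  then have "AE x in lebesgue. x \<notin> {1/4<..<3/4::real}"
    by (subst (asm) AE_restrict_space_iff) (auto elim!: eventually_mono)
  then have "{1/4<..<3/4::real} \<in> null_sets lebesgue"
    by (subst (asm) AE_iff_null_sets[symmetric]) auto
  then have "negligible {1/4<..<3/4::real}" by (simp add: negligible_iff_null_sets)
  then show False using open_not_negligible[of "{1/4<..<3/4::real}"] by auto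
qed

text \<open>The extinction time \<open>n / a0\<close> is the same for all classical solutions and hence carries over to
their limits in the \<open>L\<^sup>2\<close> norm.\<close>

section \<open>The characterization\<close>

lemma nilpotent_imp_robust_FTS:
  fixes W :: "real mat"
  assumes n: "n > 0" and W: "W \<in> carrier_mat n n" and nn: "\<And>i j. i < n \<Longrightarrow> j < n \<Longrightarrow> W $$ (i, j) \<ge> 0"
    and m: "m \<le> n" and nilp: "W ^\<^sub>m n = 0\<^sub>m n n"
  shows "robust_FTS n m (\<lambda>j k t. q j k t * W $$ (j, k))"
  unfolding robust_FTS_def
proof (intro allI impI)
  fix a b assume adm: "admissible n m a b"
  then obtain a0 where a0: "a0 > 0"
    and speed: "\<forall>x\<in>{0..1}. \<forall>t\<in>{0..}. (\<forall>j<m. a j x t \<ge> a0) \<and> (\<forall>j\<in>{m..<n}. a j x t \<le> - a0)"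
    and b: "\<And>j. j < n \<Longrightarrow> C1_bounded_strip (b j)"
    unfolding admissible_def by blast
  let ?p = "\<lambda>j k t. q j k t * W $$ (j, k)"
  define Te where "Te = real n / a0"
  have Te: "Te > 0" using a0 n by (simp add: Te_def)
  have "AE x in lebesgue_on {0<..<1}. u j x t = 0"
    if \<phi>: "\<forall>j<n. \<phi> j \<in> L2" and gen: "L2_generalized_solution n m a b ?p \<phi> u" and t: "t > Te" and j: "j < n"
    for \<phi> u t j
  proof -
    obtain \<phi>l where \<phi>l: "\<And>l j. j < n \<Longrightarrow> test_function (\<phi>l l j)"
      "(\<lambda>l. L2_norm_vec n (\<lambda>j x. \<phi>l l j x - \<phi> j x)) \<longlonglongrightarrow> 0"
      using approx_initial_data[OF n, of \<phi>] \<phi> by auto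
    then obtain ul where ul: "\<And>l :: nat. classical_solution n m a b ?p (\<phi>l l) (ul l)"
      and lim: "\<And>T. T > 0 \<Longrightarrow> uniform_limit {0..T} (\<lambda>l t. L2_norm_vec n (\<lambda>j x. u j x t - ul l j x t)) (\<lambda>t. 0) sequentially"
      using gen unfolding L2_generalized_solution_def by blast
    have u_L2: "(\<lambda>x. u j x t) \<in> L2"
      using gen j t Te unfolding L2_generalized_solution_def C_L2_def by auto
    have "ul l j x t = 0" if "x \<in> {0..1}" for l x
      by (rule classical_solution_vanishes[OF W nn m ul b a0 speed j, where s = n])
         (use nilp j that t in \<open>auto simp: Te_def\<close>)
    then have "L2_norm (\<lambda>x. u j x t - ul l j x t) = L2_norm (\<lambda>x. u j x t)" for l
      unfolding L2_norm_def by (intro arg_cong[where f = sqrt] Bochner_Integration.integral_cong) auto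
    then have le: "L2_norm (\<lambda>x. u j x t) \<le> L2_norm_vec n (\<lambda>j x. u j x t - ul l j x t)" for l
      using L2_norm_le_vec[OF j, of "\<lambda>j x. u j x t - ul l j x t"] by simp
    have "(\<lambda>l. L2_norm_vec n (\<lambda>j x. u j x t - ul l j x t)) \<longlonglongrightarrow> 0"
      using tendsto_uniform_limitI[OF lim[of t], of t] t Te by auto
    then have "L2_norm (\<lambda>x. u j x t) \<le> 0"
      by (rule LIMSEQ_le_const) (use le in auto)
    then have "(\<integral>x. (u j x t)\<^sup>2 \<partial>lebesgue_on {0<..<1}) \<le> 0" by (simp add: L2_norm_def)
    moreover have "(\<integral>x. (u j x t)\<^sup>2 \<partial>lebesgue_on {0<..<1}) \<ge> 0" by simp
    ultimately have "(\<integral>x. (u j x t)\<^sup>2 \<partial>lebesgue_on {0<..<1}) = 0" by linarith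
    then have "AE x in lebesgue_on {0<..<1}. (u j x t)\<^sup>2 = 0"
      using u_L2 by (subst (asm) integral_nonneg_eq_0_iff_AE) (auto simp: L2_def)
    then show ?thesis by simp
  qed
  then show "FTS n m a b ?p" unfolding FTS_def using Te by blast
qed

theorem theorem1p11:
  fixes n m :: nat and W :: "real mat"
  assumes "n \<ge> 2" and "m \<le> n"
    and "W \<in> carrier_mat n n"
    and "\<forall>j<n. \<forall>k<n. W $$ (j, k) = 0 \<or> W $$ (j, k) = 1"
  shows "((\<forall>q :: nat \<Rightarrow> nat \<Rightarrow> real \<Rightarrow> real.
             (\<forall>j<n. \<forall>k<n. C1_halfline (q j k)) \<longrightarrow>
             robust_FTS n m (\<lambda>j k t. q j k t * W $$ (j, k)))
          \<longleftrightarrow> walk_products_vanish n W \<or> principal_minors_vanish n W \<or> W ^\<^sub>m n = 0\<^sub>m n n)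
       \<and> (walk_products_vanish n W \<longleftrightarrow> principal_minors_vanish n W)
       \<and> (principal_minors_vanish n W \<longleftrightarrow> W ^\<^sub>m n = 0\<^sub>m n n)"
proof -
  have n: "n > 0" using assms(1) by simp
  have nn: "W $$ (i, j) \<ge> 0" if "i < n" "j < n" for i j
    using assms(4) that by (metis order_refl zero_le_one)
  have nilpotent: "W ^\<^sub>m n = 0\<^sub>m n n \<longleftrightarrow> (\<nexists>I. sinkless n W I)"
    by (rule pow_mat_eq_0_iff_sinkless[OF assms(3) nn])
  have minors: "principal_minors_vanish n W \<longleftrightarrow> (\<nexists>I. sinkless n W I)"
    by (rule principal_minors_vanish_iff_sinkless[OF assms(3)])
  have "(\<forall>q :: nat \<Rightarrow> nat \<Rightarrow> real \<Rightarrow> real. (\<forall>j<n. \<forall>k<n. C1_halfline (q j k)) \<longrightarrow>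
      robust_FTS n m (\<lambda>j k t. q j k t * W $$ (j, k))) \<longleftrightarrow> (\<nexists>I. sinkless n W I)"
  proof
    assume robust: "\<forall>q :: nat \<Rightarrow> nat \<Rightarrow> real \<Rightarrow> real. (\<forall>j<n. \<forall>k<n. C1_halfline (q j k)) \<longrightarrow>
      robust_FTS n m (\<lambda>j k t. q j k t * W $$ (j, k))"
    have "C1_halfline (\<lambda>_. 1)"
      unfolding C1_halfline_def by (intro exI[of _ "\<lambda>_. 0"]) auto
    then have "robust_FTS n m (\<lambda>j k t. W $$ (j, k))"
      using robust[rule_format, of "\<lambda>_ _ _. 1"] by simp
    then have "FTS n m (unit_speed m) (\<lambda>_ _ _. 0) (\<lambda>j k t. W $$ (j, k))"
      using unit_speed_admissible[OF assms(2)] unfolding robust_FTS_def by blast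
    then show "\<nexists>I. sinkless n W I"
      using sinkless_not_FTS[OF assms(3) nn assms(2)] by blast
  next
    assume "\<nexists>I. sinkless n W I"
    then show "\<forall>q :: nat \<Rightarrow> nat \<Rightarrow> real \<Rightarrow> real. (\<forall>j<n. \<forall>k<n. C1_halfline (q j k)) \<longrightarrow>
      robust_FTS n m (\<lambda>j k t. q j k t * W $$ (j, k))"
      using nilpotent_imp_robust_FTS[OF n assms(3) nn assms(2)] nilpotent by blast
  qed
  then show ?thesis
    using walk_products_vanish_iff_sinkless[of n W] minors nilpotent by blast
qed

end
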